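(* Let $q\in(0,1)$ and $\nu>-1$. Then the radius of starlikeness $r^*\left(h_{\nu}^{(2)}(\cdot;q)\right)$ of the function $$z\mapsto h_{\nu}^{(2)}(z;q)=2^{\nu}c_{\nu}(q)z^{1-\frac{\nu}{2}}J_{\nu}^{(2)}(\sqrt{z};q)$$ is the smallest positive root of the equation $r\cdot \frac{d}{dr}J_{\nu}^{(2)}(r;q)-(\nu-2)J_{\nu}^{(2)}(r;q)=0$ and satisfies $$\frac{2(1-q)(1-q^{\nu+1})}{q^{\nu+1}}<r^*\left(h_{\nu}^{(2)}(\cdot;q)\right)< \frac{4(q^{\nu+1}-1)(q^{\nu+2}-1)(1-q^2)}{q^{\nu+1}\left(2q-2q^{\nu+2}+q^{\nu+3}-3q^2+2\right)}$$ and $$\sqrt{\frac{8(q^{\nu+1}-1)^2(1-q^{\nu+2})(q-1)^2(q+1)}{q^{2\nu+2}\left(2q-2q^{\nu+2}+q^{\nu+3}-3q^2+2\right)}}< r^*\left(h_{\nu}^{(2)}(\cdot;q)\right)<\frac{4(q^{\nu+1}-1)(q^{\nu+3}-1)(q^3-1)}{q^{\nu+1}}\,q_2^*(\nu),$$ where $$q_2^*(\nu)=\frac{2q-2q^{\nu+2}+q^{\nu+3}-3q^2+2}{c_{\nu}(q)+d_{\nu}(q)},$$ $$c_{\nu}(q)=4q^{\nu+2}+3q^{\nu+3}+7q^{\nu+4}-6q^{\nu+5}-5q^{\nu+6}+3q^{\nu+7}-4q^{2\nu+5}+q^{2\nu+6},$$ $$d_{\nu}(q)=q^{2\nu+7}-q^{2\nu+8}-8q+q^2+5q^3+9q^4-6q^6-4.$$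 (Here $c_\nu(q)$ in the definition of $q_2^*$ denotes the displayed polynomial, not the normalizing constant.)
   Context: For $a\in\mathbb{C}$ and $q\in(0,1)$: $(a;q)_0=1$, $(a;q)_n=\prod_{k=1}^{n}(1-aq^{k-1})$, $(a;q)_\infty=\prod_{k\geq1}(1-aq^{k-1})$. The Jackson $q$-Bessel function is, for $\nu>-1$, $$J_{\nu}^{(2)}(z;q)=\frac{(q^{\nu+1};q)_{\infty}}{(q;q)_{\infty}}\sum_{n\geq0}\frac{(-1)^{n}\left(\frac{z}{2}\right)^{2n+\nu}}{(q;q)_{n}(q^{\nu+1};q)_{n}}q^{n(n+\nu)}.$$ In the definition of $h_\nu^{(2)}$, the constant $c_{\nu}(q)=(q;q)_{\infty}/(q^{\nu+1};q)_{\infty}$; thus $h_\nu^{(2)}(z;q)=\sum_{n\ge0}\frac{(-1)^n q^{n(n+\nu)}}{2^{2n}(q;q)_n(q^{\nu+1};q)_n}z^{n+1}$ is entire with $h(0)=0$, $h'(0)=1$. For such $f$, the radius of starlikeness is $r^*(f)=\sup\{r>0:\ \mathrm{Re}\,(zf'(z)/f(z))>0 \text{ for all } |z|<r\}$.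
   Formalization: The radius of starlikeness is shown to be the square of the smallest positive root of the displayed equation, not the root itself: since h involves J at √z, the literal claim fails (e.g. q=1/2, ν=1, where the radius exceeds 3). *)

theory Defs
  imports "HOL-Analysis.Analysis"
begin

definition qpoch :: "real \<Rightarrow> real \<Rightarrow> nat \<Rightarrow> real" where
  "qpoch a q n = (\<Prod>k<n. 1 - a * q ^ k)"

definition qpoch_inf :: "real \<Rightarrow> real \<Rightarrow> real" where
  "qpoch_inf a q = (\<Prod>k. 1 - a * q ^ k)"

definition jacksonJ2 :: "real \<Rightarrow> real \<Rightarrow> real \<Rightarrow> real" where
  "jacksonJ2 \<nu> q r =
     qpoch_inf (q powr (\<nu> + 1)) q / qpoch_inf q q *
     (\<Sum>n. (-1) ^ n * (r / 2) powr (2 * real n + \<nu>) * q powr (real n * (real n + \<nu>))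
            / (qpoch q q n * qpoch (q powr (\<nu> + 1)) q n))"

definition hcoef :: "real \<Rightarrow> real \<Rightarrow> nat \<Rightarrow> real" where
  "hcoef \<nu> q n = (-1) ^ n * q powr (real n * (real n + \<nu>))
                  / (2 ^ (2 * n) * qpoch q q n * qpoch (q powr (\<nu> + 1)) q n)"

definition h2 :: "real \<Rightarrow> real \<Rightarrow> complex \<Rightarrow> complex" where
  "h2 \<nu> q z = (\<Sum>n. complex_of_real (hcoef \<nu> q n) * z ^ Suc n)"

text \<open>Radius of starlikeness. The point z = 0 (where z f'(z)/f(z) is understood as its
  limit 1) is excluded from the condition.\<close>
definition radius_starlike :: "(complex \<Rightarrow> complex) \<Rightarrow> real" where
  "radius_starlike f = Sup {r. r > 0 \<and>
      (\<forall>z. 0 < cmod z \<and> cmod z < r \<longrightarrow> Re (z * deriv f z / f z) > 0)}"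

end

theory Submission
  imports Defs "HOL-Complex_Analysis.Cauchy_Integral_Formula"
begin

text \<open>
  The function \<open>h(z)/z\<close> is a limit of rescaled \<open>q\<close>-Laguerre polynomials \<open>P\<^sub>n\<close>. Their three-term recurrence
  shows by induction that \<open>P\<^sub>n\<^sub>+\<^sub>1/P\<^sub>n\<close> maps the upper half-plane into the lower one, so that all roots of
  \<open>P\<^sub>n\<close> are real, and positive because the coefficients alternate. The same holds for the derivative
  \<open>G\<^sub>n\<close> of \<open>z P\<^sub>n\<close>, as \<open>G\<^sub>n/P\<^sub>n\<close> again has negative imaginary part in the upper half-plane.

  Working with these polynomials replaces the Hadamard factorization of \<open>h\<close>. If \<open>1/x\<^sub>i\<close> are the roots of
  \<open>G\<^sub>n\<close>, then by Newton's identities the power sums \<open>\<Sum>x\<^sub>i\<^sup>k\<close> converge to numbers \<open>\<kappa>\<^sub>k\<close> computed from the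
  coefficients of \<open>h'\<close>, and the largest \<open>x\<^sub>i\<close> accumulates at some \<open>X\<close> such that \<open>1/X\<close> is the smallest
  positive root of \<open>h'\<close>. The bounds are \<open>X\<^sup>k \<le> \<kappa>\<^sub>k\<close> and \<open>\<kappa>\<^sub>k\<^sub>+\<^sub>1 \<le> X \<kappa>\<^sub>k\<close> for small \<open>k\<close>; equality would
  force \<open>\<kappa>\<close> to be geometric from some point on, which contradicts the super-exponential decay of the coefficients.

  Finally \<open>Re (z G\<^sub>n(z) / (z P\<^sub>n(z))) \<ge> G\<^sub>n(r)/P\<^sub>n(r)\<close> for \<open>\<bar>z\<bar> = r\<close> below the smallest root of \<open>P\<^sub>n\<close>,
  so the radius of starlikeness is \<open>1/X\<close>.
\<close>

section \<open>Polynomials with positive roots\<close>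

text \<open>Normalizing the constant coefficient to 1 makes the list entries the reciprocals of the
  roots, so the smallest positive root corresponds to the largest entry.\<close>

definition linprod :: "real list \<Rightarrow> real poly" where
  "linprod xs = (\<Prod>x\<leftarrow>xs. [:1, - x:])"

text \<open>The exponent is shifted so that these are exactly the coefficients of the power series
  of \<open>- P' / P\<close>.\<close>

definition psum :: "real list \<Rightarrow> nat \<Rightarrow> real" where
  "psum xs k = (\<Sum>x\<leftarrow>xs. x ^ Suc k)"

text \<open>One notation for real and complex arguments lets each evaluation lemma serve both the
  half-plane arguments and the bounds on the positive axis.\<close>

abbreviation evalp :: "real poly \<Rightarrow> 'a::real_field \<Rightarrow> 'a" where
  "evalp p z \<equiv> poly (map_poly of_real p) z"

section \<open>Evaluation and factorization of real polynomials\<close>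

lemma map_poly_of_real_pCons [simp]:
  "map_poly (of_real :: real \<Rightarrow> 'a::real_field) (pCons a p) = pCons (of_real a) (map_poly of_real p)"
  by (simp add: map_poly_pCons)

lemma evalp_real [simp]: "evalp p (x::real) = poly p x"
  by (induction p) auto

lemma evalp_of_real: "evalp p (of_real x :: 'a::real_field) = of_real (poly p x)"
  by (induction p) auto

lemma evalp_add: "evalp (p + r) (z::'a::real_field) = evalp p z + evalp r z"
  by (induction p r rule: poly_induct2) (auto simp: algebra_simps)

lemma evalp_smult: "evalp (smult c p) (z::'a::real_field) = of_real c * evalp p z"
  by (induction p) (auto simp: algebra_simps)

lemma evalp_mult: "evalp (p * r) (z::'a::real_field) = evalp p z * evalp r z"
  by (induction p) (auto simp: algebra_simps evalp_add evalp_smult)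

lemma evalp_cnj: "evalp p (cnj z) = cnj (evalp p z)"
  by (induction p) auto

lemma linprod_Nil [simp]: "linprod [] = 1"
  and linprod_Cons [simp]: "linprod (x # xs) = [:1, - x:] * linprod xs"
  by (simp_all add: linprod_def)

lemma coeff_linprod_0: "coeff (linprod xs) 0 = 1"
  by (induction xs) (auto simp: coeff_mult)

lemma evalp_linprod: "evalp (linprod xs) (z::'a::real_field) = (\<Prod>x\<leftarrow>xs. 1 - of_real x * z)"
  by (induction xs) (simp_all only: linprod_Cons evalp_mult, simp_all add: mult.commute)

text \<open>Induction on the degree: the fundamental theorem of algebra supplies a root, which is a
  positive real \<open>t\<close> by assumption and contributes the entry \<open>1/t\<close>.\<close>

lemma real_rooted_imp_linprod:
  fixes p :: "real poly"
  assumes "coeff p 0 = 1" and "\<And>z::complex. evalp p z = 0 \<Longrightarrow> Im z = 0 \<and> Re z > 0"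
  shows "\<exists>xs. (\<forall>x\<in>set xs. x > 0) \<and> p = linprod xs"
  using assms
proof (induction "degree p" arbitrary: p)
  case 0
  then obtain a where "p = [:a:]" using degree_eq_zeroE by metis
  with 0 have "p = linprod []" by (simp add: one_pCons)
  then show ?case by (intro exI[of _ "[]"]) simp
next
  case (Suc d)
  have deg: "degree (map_poly (of_real :: real \<Rightarrow> complex) p) = degree p"
    by (rule degree_map_poly) auto
  have "coeff p (degree p) \<noteq> 0" using Suc(2) by auto
  then have "\<exists>i\<in>{1..degree p}. complex_of_real (coeff p i) \<noteq> 0"
    using Suc(2) by (intro bexI[of _ "degree p"]) auto
  then obtain z where "(\<Sum>i\<le>degree p. complex_of_real (coeff p i) * z ^ i) = 0"
    using fundamental_theorem_of_algebra[of "\<lambda>i. complex_of_real (coeff p i)" "degree p"] by blast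
  then have z: "evalp p z = 0" by (simp add: poly_altdef deg coeff_map_poly)
  define t where "t = Re z"
  have zt: "z = of_real t" "t > 0" using Suc.prems(2)[OF z] by (auto simp: t_def complex_eq_iff)
  have "poly p t = 0" using z unfolding zt(1) evalp_of_real by simp
  then obtain r where r: "p = [:- t, 1:] * r" by (auto simp: poly_eq_0_iff_dvd dvd_def)
  \<comment> \<open>Moving the scalar \<open>- t\<close> into the cofactor turns
    \<open>z - t\<close> into \<open>1 - z/t\<close>, so the cofactor again has constant coefficient
    1.\<close>
  define s where "s = smult (- t) r"
  have ps: "p = [:1, - (1/t):] * s" unfolding s_def r using zt(2) 
    by (auto simp: algebra_simps)
  have s0: "coeff s 0 = 1" using Suc.prems(1) unfolding ps by (simp add: coeff_mult)
  then have "s \<noteq> 0" by auto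
  then have "degree p = 1 + degree s" unfolding ps using zt(2) by (subst degree_mult_eq) auto
  then have ds: "d = degree s" using Suc(2) by simp
  have "evalp s w = 0 \<Longrightarrow> Im w = 0 \<and> Re w > 0" for w :: complex
    by (rule Suc.prems(2)) (simp only: ps evalp_mult mult_zero_right)
  from Suc.hyps(1)[OF ds s0 this] obtain xs where "\<forall>x\<in>set xs. x > 0" "s = linprod xs" by blast
  with ps zt(2) show ?case by (intro exI[of _ "1/t # xs"]) simp
qed

text \<open>Logarithmic differentiation of \<open>z P(z)\<close>, carried out by the product rule
  along the list. It underlies both the location of the roots of the derivative and
  starlikeness.\<close>

lemma evalp_pderiv_linprod:
  fixes z :: "'a::real_field"
  assumes "\<And>x. x \<in> set xs \<Longrightarrow> 1 - of_real x * z \<noteq> 0"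
  shows "evalp (pderiv (pCons 0 (linprod xs))) z =
         evalp (linprod xs) z * (1 - (\<Sum>x\<leftarrow>xs. of_real x * z / (1 - of_real x * z)))"
  using assms
proof (induction xs)
  case Nil
  then show ?case by (simp add: pderiv_pCons)
next
  case (Cons x xs)
  define P where "P = evalp (linprod xs) z"
  define D where "D = evalp (pderiv (linprod xs)) z"
  define S where "S = (\<Sum>x\<leftarrow>xs. of_real x * z / (1 - of_real x * z))"
  have nz: "1 - of_real x * z \<noteq> 0" using Cons.prems by simp
  have IH: "P + z * D = P * (1 - S)"
    using Cons by (simp add: pderiv_pCons evalp_add P_def D_def S_def)
  have e1: "evalp (linprod (x # xs)) z = (1 - of_real x * z) * P"
    by (simp only: linprod_Cons evalp_mult P_def) simp
  have e2: "evalp (pderiv (linprod (x # xs))) z = (1 - of_real x * z) * D - of_real x * P"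
    by (simp only: linprod_Cons pderiv_mult evalp_mult evalp_add) 
       (simp add: P_def D_def pderiv_pCons evalp_mult)
  have "evalp (pderiv (pCons 0 (linprod (x # xs)))) z = (1 - of_real x * z) * P + z * ((1 - of_real x * z) * D - of_real x * P)"
    by (simp only: pderiv_pCons evalp_add e1 e2 map_poly_of_real_pCons poly_pCons) simp
  also have "\<dots> = (1 - of_real x * z) * (P + z * D) - of_real x * z * P" by (simp add: algebra_simps)
  also have "\<dots> = (1 - of_real x * z) * P * (1 - (of_real x * z / (1 - of_real x * z) + S))"
    unfolding IH using nz by (simp add: field_simps)
  finally show ?case unfolding e1 by (simp add: S_def)
qed

lemma linprod_nonreal:
  assumes "\<And>x. x \<in> set xs \<Longrightarrow> x > 0" "Im z \<noteq> 0" "x \<in> set xs"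
  shows "1 - of_real x * z \<noteq> 0"
  using assms by (auto simp: complex_eq_iff)

text \<open>In the upper half-plane every summand of the logarithmic derivative has positive
  imaginary part, so the quotient of \<open>(z P)'\<close> by \<open>P\<close> has negative
  imaginary part. For the empty list the derivative is 1.\<close>

lemma pderiv_linprod_nonreal_aux:
  assumes "\<And>x. x \<in> set xs \<Longrightarrow> x > 0" "Im z > 0"
  shows "evalp (pderiv (pCons 0 (linprod xs))) z \<noteq> 0"
proof (cases "xs = []")
  case True
  then show ?thesis by (simp add: pderiv_pCons)
next
  case False
  have nz: "1 - of_real x * z \<noteq> 0" if "x \<in> set xs" for x
    using linprod_nonreal[of xs z x] assms that by auto
  have pos: "Im (of_real x * z / (1 - of_real x * z)) > 0" if "x \<in> set xs" for x
  proof -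
    have x: "x > 0" using assms that by auto
    \<comment> \<open>In this form the imaginary part comes from the reciprocal of
      \<open>1 - x z\<close> alone.\<close>
    have "of_real x * z / (1 - of_real x * z) = 1 / (1 - of_real x * z) - 1"
      using nz[OF that] by (simp add: field_simps)
    also have "Im \<dots> = x * Im z / (cmod (1 - of_real x * z))\<^sup>2"
      by (simp add: Im_divide cmod_power2)
    also have "\<dots> > 0" using x assms nz[OF that] by simp
    finally show ?thesis .
  qed
  have "Im (\<Sum>x\<leftarrow>ys. of_real x * z / (1 - of_real x * z)) > 0" if "set ys \<subseteq> set xs" "ys \<noteq> []" for ys
    using that
  proof (induction ys)
    case (Cons y ys)
    then show ?case using pos[of y] by (cases "ys = []") auto
  qed auto
  from this[of xs] False have "Im (1 - (\<Sum>x\<leftarrow>xs. of_real x * z / (1 - of_real x * z))) < 0" by simp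
  then have "1 - (\<Sum>x\<leftarrow>xs. of_real x * z / (1 - of_real x * z)) \<noteq> 0" by force
  moreover have "evalp (linprod xs) z \<noteq> 0" using nz by (auto simp: evalp_linprod prod_list_zero_iff)
  ultimately show ?thesis by (subst evalp_pderiv_linprod) (use nz in auto)
qed

lemma pderiv_linprod_nonreal:
  assumes "\<And>x. x \<in> set xs \<Longrightarrow> x > 0" "Im z \<noteq> 0"
  shows "evalp (pderiv (pCons 0 (linprod xs))) z \<noteq> 0"
proof (cases "Im z > 0")
  case False
  then have "evalp (pderiv (pCons 0 (linprod xs))) (cnj z) \<noteq> 0"
    using assms by (intro pderiv_linprod_nonreal_aux) auto
  then show ?thesis by (simp add: evalp_cnj)
qed (use assms pderiv_linprod_nonreal_aux in auto)

lemma Re_div_one_minus_le: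
  assumes "cmod w < 1"
  shows "Re (w / (1 - w)) \<le> cmod w / (1 - cmod w)"
proof -
  have "1 - cmod w \<le> cmod (1 - w)" using norm_triangle_ineq2[of 1 w] by simp
  then have "cmod (w / (1 - w)) \<le> cmod w / (1 - cmod w)" 
    using assms by (auto simp: norm_divide intro!: divide_left_mono mult_pos_pos)
  then show ?thesis using complex_Re_le_cmod order_trans by blast
qed

text \<open>On a circle inside the zero-free disc the logarithmic derivative has its smallest real part
  on the positive axis, since the zeros are positive.\<close>
lemma linprod_starlike:
  assumes "\<And>x. x \<in> set xs \<Longrightarrow> x > 0" "\<And>x. x \<in> set xs \<Longrightarrow> x * cmod z < 1"
  defines "P \<equiv> linprod xs" and "r \<equiv> cmod z"
  defines "G \<equiv> pderiv (pCons 0 P)"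
  shows "poly G r / poly P r \<le> Re (evalp G z / evalp P z)"
    and "0 < poly P r" "poly P r \<le> cmod (evalp P z)" "poly G r \<le> poly P r"
proof -
  have n1: "1 - x * r > 0" if "x \<in> set xs" for x using assms(2)[OF that] by (simp add: r_def)
  have n2: "1 - x * r \<le> cmod (1 - of_real x * z)" if "x \<in> set xs" for x
    using norm_triangle_ineq2[of 1 "of_real x * z"] assms(1)[OF that] by (simp add: r_def norm_mult)
  have n3: "1 - of_real x * z \<noteq> 0" if "x \<in> set xs" for x using n1[OF that] n2[OF that] by auto
  have Pr: "poly P r = (\<Prod>x\<leftarrow>xs. 1 - x * r)" 
    using evalp_linprod[of xs r] unfolding P_def by simp
  have Pz: "evalp P z = (\<Prod>x\<leftarrow>xs. 1 - of_real x * z)" unfolding P_def by (rule evalp_linprod)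
  have *: "0 < (\<Prod>x\<leftarrow>ys. 1 - x * r) \<and> (\<Prod>x\<leftarrow>ys. 1 - x * r) \<le> cmod (\<Prod>x\<leftarrow>ys. 1 - of_real x * z)"
    if "set ys \<subseteq> set xs" for ys using that
  proof (induction ys)
    case (Cons y ys)
    then show ?case using n1[of y] n2[of y] by (auto simp: norm_mult intro!: mult_mono)
  qed auto
  show P0: "0 < poly P r" and "poly P r \<le> cmod (evalp P z)" using *[of xs] by (auto simp: Pr Pz)
  then have Pz0: "evalp P z \<noteq> 0" by auto
  have Gr: "poly G r = poly P r * (1 - (\<Sum>x\<leftarrow>xs. x * r / (1 - x * r)))"
    using evalp_pderiv_linprod[of xs r] n1 unfolding G_def P_def by force
  have Gz: "evalp G z = evalp P z * (1 - (\<Sum>x\<leftarrow>xs. of_real x * z / (1 - of_real x * z)))"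
    using evalp_pderiv_linprod[of xs z] n3 unfolding G_def P_def by force
  have "(\<Sum>x\<leftarrow>xs. x * r / (1 - x * r)) \<ge> 0"
    using n1 assms(1) by (intro sum_list_nonneg) (auto simp: r_def intro!: divide_nonneg_pos simp: less_imp_le)
  then show "poly G r \<le> poly P r" unfolding Gr using P0 by (simp add: mult_le_cancel_left1)
  have "Re (\<Sum>x\<leftarrow>ys. of_real x * z / (1 - of_real x * z)) \<le> (\<Sum>x\<leftarrow>ys. x * r / (1 - x * r))"
    if "set ys \<subseteq> set xs" for ys using that
  proof (induction ys)
    case (Cons y ys)
    have "Re (of_real y * z / (1 - of_real y * z)) \<le> y * r / (1 - y * r)"
      using Re_div_one_minus_le[of "of_real y * z"] Cons.prems assms(1)[of y] assms(2)[of y] 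
      by (simp add: norm_mult r_def)
    then show ?case using Cons by simp
  qed auto
  from this[of xs] show "poly G r / poly P r \<le> Re (evalp G z / evalp P z)"
    using P0 Pz0 by (simp add: Gr Gz)
qed

text \<open>Formal version of \<open>P'/P = - (sum of x / (1 - x z))\<close>; Newton's identities
  are read off from its coefficients.\<close>

lemma psum_deriv_gen:
  "fps_of_poly (pderiv (linprod xs)) = - fps_of_poly (linprod xs) * Abs_fps (psum xs)"
proof (induction xs)
  case Nil
  have "Abs_fps (psum []) = 0" by (intro fps_ext) (simp add: psum_def)
  then show ?case by simp
next
  case (Cons x xs)
  define Q where "Q = fps_of_poly (linprod xs)"
  define A where "A = fps_of_poly [:1, -x:]"
  define g where "g = Abs_fps (\<lambda>k. x ^ Suc k)"
  \<comment> \<open>\<open>g\<close> is the geometric series of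
    \<open>x / (1 - x z)\<close>.\<close>
  have "A * g = fps_const x"
  proof (rule fps_ext)
    fix n show "fps_nth (A * g) n = fps_nth (fps_const x) n"
      by (cases n) (auto simp: A_def g_def fps_of_poly_pCons algebra_simps)
  qed
  moreover have "Abs_fps (psum (x # xs)) = g + Abs_fps (psum xs)"
    by (intro fps_ext) (simp add: psum_def g_def)
  moreover have "fps_of_poly (pderiv [:1, -x:]) = - fps_const x" 
    by (simp add: pderiv_pCons fps_of_poly_const flip: fps_const_neg)
  moreover have "- A * (Q * (g + Abs_fps (psum xs))) = - (A * g) * Q + A * (- Q * Abs_fps (psum xs))"
    by (simp add: algebra_simps)
  ultimately show ?case using Cons
    by (simp only: linprod_Cons pderiv_mult fps_of_poly_add fps_of_poly_mult flip: A_def Q_def)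
       (simp add: algebra_simps flip: fps_const_neg)
qed

lemma newton_psum:
  "real (Suc n) * coeff (linprod xs) (Suc n) = - (\<Sum>i\<le>n. coeff (linprod xs) i * psum xs (n - i))"
proof -
  have "coeff (pderiv (linprod xs)) n = fps_nth (- fps_of_poly (linprod xs) * Abs_fps (psum xs)) n"
    by (subst psum_deriv_gen[symmetric]) simp
  then show ?thesis by (simp add: coeff_pderiv fps_mult_nth sum_negf atMost_atLeast0)
qed

section \<open>Limits of polynomials with positive roots\<close>

text \<open>\<open>coeff_le\<close> provides the majorant for Tannery's theorem.
  \<open>ratio\<close> is stronger than what an infinite radius of convergence requires: it also
  rules out \<open>e^(c z)\<close> with nonzero \<open>c\<close>, for which the limit would be
  \<open>c\<close>.\<close>

locale poly_limit =
  fixes p :: "nat \<Rightarrow> real poly" and m :: "nat \<Rightarrow> real"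
  assumes coeff_lim: "\<And>k. (\<lambda>n. coeff (p n) k) \<longlonglongrightarrow> m k"
    and coeff_le: "\<And>n k. \<bar>coeff (p n) k\<bar> \<le> \<bar>m k\<bar>"
    and m_nonzero: "\<And>k. m k \<noteq> 0"
    and ratio: "(\<lambda>k. real (Suc k) * (m (Suc k) / m k)) \<longlonglongrightarrow> 0"
begin

definition limfun :: "'a::{real_normed_field,banach} \<Rightarrow> 'a" where
  "limfun z = (\<Sum>k. of_real (m k) * z ^ k)"

lemma ratio0: "(\<lambda>k. m (Suc k) / m k) \<longlonglongrightarrow> 0"
proof -
  have "(\<lambda>k. inverse (real (Suc k)) * (real (Suc k) * (m (Suc k) / m k))) \<longlonglongrightarrow> 0 * 0"
    by (intro tendsto_mult ratio LIMSEQ_inverse_real_of_nat)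
  then show ?thesis by (simp only: mult.assoc[symmetric] left_inverse of_nat_neq_0 not_False_eq_True mult_1_left mult_zero_left)
qed

lemma summable_abs: "summable (\<lambda>k. \<bar>m k\<bar> * R ^ k)"
proof (cases "R = 0")
  case True
  then show ?thesis by (intro summable_finite[of "{0}"]) auto
next
  case False
  have "eventually (\<lambda>k. \<bar>m (Suc k) / m k\<bar> < 1 / (2 * \<bar>R\<bar>)) sequentially"
    using tendsto_rabs[OF ratio0] False by (intro order_tendstoD(2)[where y=0]) auto
  then obtain N where N: "\<And>k. k \<ge> N \<Longrightarrow> \<bar>m (Suc k) / m k\<bar> < 1 / (2 * \<bar>R\<bar>)"
    by (auto simp: eventually_sequentially)
  show ?thesis
  proof (rule summable_ratio_test[of "1/2" N])
    fix k assume "k \<ge> N"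
    then have "\<bar>m (Suc k)\<bar> \<le> \<bar>m k\<bar> / (2 * \<bar>R\<bar>)" using N[of k] m_nonzero[of k] 
      by (simp add: field_simps)
    then have "\<bar>m (Suc k)\<bar> * \<bar>R\<bar> \<le> \<bar>m k\<bar> / 2" using False by (simp add: field_simps)
    then have "\<bar>m (Suc k)\<bar> * \<bar>R\<bar> * \<bar>R\<bar> ^ k \<le> \<bar>m k\<bar> / 2 * \<bar>R\<bar> ^ k" by (intro mult_right_mono) auto
    then show "norm (\<bar>m (Suc k)\<bar> * R ^ Suc k) \<le> 1 / 2 * norm (\<bar>m k\<bar> * R ^ k)"
      by (simp add: abs_mult power_abs algebra_simps)
  qed auto
qed

lemma summable_limfun: "summable (\<lambda>k. of_real (m k) * (z::'a::{real_normed_field,banach}) ^ k)"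
  using summable_abs[of "norm z"] by - (rule summable_norm_cancel, simp add: norm_mult norm_power)

lemma limfun_of_real: "limfun (of_real x :: 'a::{real_normed_field,banach}) = of_real (limfun x)"
proof -
  have "summable (\<lambda>k. m k * x ^ k)" using summable_limfun[of x] by simp
  from suminf_of_real[OF this, where 'a = 'a] show ?thesis
    unfolding limfun_def by simp
qed

lemma evalp_suminf: "(\<Sum>k. of_real (coeff r k) * (z::'a::{real_normed_field,banach}) ^ k) = evalp r z"
proof -
  have "degree (map_poly (of_real :: real \<Rightarrow> 'a) r) = degree r" by (rule degree_map_poly) auto
  then have "evalp r z = (\<Sum>k\<le>degree r. of_real (coeff r k) * z ^ k)"
    by (simp add: poly_altdef coeff_map_poly)
  also have "\<dots> = (\<Sum>k. of_real (coeff r k) * z ^ k)"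
    by (subst suminf_finite[of "{..degree r}"]) (auto simp: coeff_eq_0)
  finally show ?thesis ..
qed

lemma evalp_tendsto:
  fixes z :: "'a::{real_normed_field,banach}"
  assumes "strict_mono r" "w \<longlonglongrightarrow> z"
  shows "(\<lambda>n. evalp (p (r n)) (w n)) \<longlonglongrightarrow> limfun z"
proof -
  obtain R where R: "\<And>n. norm (w n) \<le> R"
    using convergent_imp_Bseq[OF convergentI[OF assms(2)]] by (auto simp: Bseq_def)
  have "norm (of_real (coeff (p (r n)) k) * w n ^ k) \<le> \<bar>m k\<bar> * R ^ k" for n k
    using coeff_le[of "r n" k] R[of n] by (auto simp: norm_mult norm_power intro!: mult_mono power_mono)
  moreover have "(\<lambda>n. coeff (p (r n)) k) \<longlonglongrightarrow> m k" for k
    using LIMSEQ_subseq_LIMSEQ[OF coeff_lim assms(1)] by (simp add: o_def)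
  ultimately have "(\<lambda>n. \<Sum>k. of_real (coeff (p (r n)) k) * w n ^ k) \<longlonglongrightarrow> (\<Sum>k. of_real (m k) * z ^ k)"
    by (intro tannerys_theorem[where M = "\<lambda>k. \<bar>m k\<bar> * R ^ k", THEN conjunct2, THEN conjunct2]
          tendsto_intros assms summable_abs always_eventually) auto
  then show ?thesis by (simp only: evalp_suminf limfun_def)
qed

text \<open>By compactness, roots in \<open>[0, R]\<close> for infinitely many \<open>n\<close>
  would accumulate at a zero of \<open>limfun\<close> in that interval.\<close>

lemma eventually_no_root:
  assumes "\<And>t::real. 0 \<le> t \<Longrightarrow> t \<le> R \<Longrightarrow> limfun t \<noteq> 0"
  shows "eventually (\<lambda>n. \<forall>t. 0 \<le> t \<and> t \<le> R \<longrightarrow> poly (p n) t \<noteq> 0) sequentially"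
proof (rule ccontr)
  assume "\<not> ?thesis"
  from not_eventually_sequentiallyD[OF this] obtain r :: "nat \<Rightarrow> nat"
    where r: "strict_mono r" "\<And>n. \<not> (\<forall>t. 0 \<le> t \<and> t \<le> R \<longrightarrow> poly (p (r n)) t \<noteq> 0)" by blast
  then have "\<exists>t. t \<in> {0..R} \<and> poly (p (r n)) t = 0" for n by force
  then obtain t where t: "\<And>n. t n \<in> {0..R}" "\<And>n. poly (p (r n)) (t n) = 0" by metis
  obtain l s where l: "l \<in> {0..R}" and s: "strict_mono s" and "(t \<circ> s) \<longlonglongrightarrow> l"
    using seq_compactE[OF compact_imp_seq_compact[OF compact_Icc[of 0 R]], of t] t(1) by metis
  then have "(\<lambda>n. evalp (p (r (s n))) (t (s n))) \<longlonglongrightarrow> limfun l"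
    using evalp_tendsto[OF strict_mono_o[OF r(1) s], of "t \<circ> s" l] by (simp add: o_def)
  then have "limfun l = 0" using t(2) by (simp add: LIMSEQ_const_iff)
  then show False using assms l by auto
qed

end

section \<open>Inequalities for power sums of positive numbers\<close>

lemma psum_Suc_le:
  assumes "\<And>x. x \<in> set xs \<Longrightarrow> 0 < x \<and> x \<le> X"
  shows "psum xs (Suc k) \<le> X * psum xs k"
  using assms unfolding psum_def
  by (induction xs) (auto simp: distrib_left less_imp_le intro!: add_mono mult_right_mono)

lemma power_le_psum:
  assumes "\<And>x. x \<in> set xs \<Longrightarrow> 0 < x" "X \<in> set xs"
  shows "X ^ Suc k \<le> psum xs k"
  using assms unfolding psum_def by (intro member_le_sum_list) (auto simp: less_imp_le)

text \<open>Each entry contributes \<open>x ^ Suc k * (x - X)^2\<close>, which is nonnegative. In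
  the limit this propagates equality in \<open>kap (Suc k) \<le> X * kap k\<close> to larger
  \<open>k\<close>.\<close>

lemma psum_quadratic:
  assumes "\<And>x. x \<in> set xs \<Longrightarrow> 0 < x"
  shows "2 * X * psum xs (Suc k) - X\<^sup>2 * psum xs k \<le> psum xs (Suc (Suc k))"
  using assms
proof (induction xs)
  case (Cons x xs)
  have "0 \<le> x ^ Suc k * (x - X)\<^sup>2" using Cons.prems[of x] by simp
  also have "\<dots> = x ^ Suc (Suc (Suc k)) - 2 * X * x ^ Suc (Suc k) + X\<^sup>2 * x ^ Suc k"
    by (simp add: power2_eq_square algebra_simps)
  finally show ?case using Cons by (simp add: psum_def algebra_simps)
qed (simp add: psum_def)

lemma one_minus_ge_exp:
  fixes y :: real
  assumes "y < 1" shows "exp (- (y / (1 - y))) \<le> 1 - y"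
proof -
  have "inverse (1 - y) = 1 + y / (1 - y)" using assms by (simp add: field_simps)
  also have "\<dots> \<le> exp (y / (1 - y))" by (rule exp_ge_add_one_self)
  finally show ?thesis using assms by (simp add: exp_minus field_simps)
qed

text \<open>Positivity alone may be lost in a limit. This lower bound depends on the list only
  through \<open>c\<close> and the first power sum, so it stays positive when the power sums
  converge.\<close>

lemma linprod_ge_exp:
  assumes "\<And>x. x \<in> set xs \<Longrightarrow> 0 < x \<and> t * x \<le> c" "c < 1" "0 \<le> t"
  shows "exp (- (t * psum xs 0 / (1 - c))) \<le> poly (linprod xs) t"
  using assms(1)
proof (induction xs)
  case (Cons x xs)
  have x: "0 < x" "t * x \<le> c" using Cons.prems[of x] by auto
  have "t * x / (1 - t * x) \<le> t * x / (1 - c)" using x assms by (intro divide_left_mono mult_pos_pos) auto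
  then have "exp (- (t * x / (1 - c))) \<le> exp (- (t * x / (1 - t * x)))" by simp
  also have "\<dots> \<le> 1 - t * x" using x assms by (intro one_minus_ge_exp) auto
  finally have "exp (- (t * x / (1 - c))) * exp (- (t * psum xs 0 / (1 - c))) \<le> (1 - t * x) * poly (linprod xs) t"
  proof (rule mult_mono)
    show "exp (- (t * psum xs 0 / (1 - c))) \<le> poly (linprod xs) t" using Cons by simp
    show "0 \<le> 1 - t * x" using x assms(2) by linarith
  qed auto
  moreover have "t * psum (x # xs) 0 / (1 - c) = t * x / (1 - c) + t * psum xs 0 / (1 - c)"
    by (simp add: psum_def add_divide_distrib distrib_left)
  ultimately show ?case by (simp add: exp_add[symmetric] algebra_simps)
qed (simp add: psum_def)

section \<open>Limiting power sums and the smallest root of the limit\<close>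

locale real_rooted_limit = poly_limit "\<lambda>n. linprod (xs n)" m for xs :: "nat \<Rightarrow> real list" and m +
  assumes xs_pos: "\<And>n x. x \<in> set (xs n) \<Longrightarrow> x > 0"
    and xs_nonempty: "\<And>n. xs n \<noteq> []"
begin

definition kap :: "nat \<Rightarrow> real" where
  "kap k = lim (\<lambda>n. psum (xs n) k)"

lemma m_0: "m 0 = 1"
  using coeff_lim[of 0] by (simp add: coeff_linprod_0 LIMSEQ_const_iff)

text \<open>As the constant coefficient is 1, Newton's identity can be solved for the highest power
  sum; convergence follows by strong induction from that of the coefficients.\<close>

lemma psum_tendsto: "(\<lambda>n. psum (xs n) k) \<longlonglongrightarrow> kap k"
proof -
  have "convergent (\<lambda>n. psum (xs n) k)"
  proof (induction k rule: less_induct)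
    case (less k)
    have eq: "psum (xs n) k = - (real (Suc k) * coeff (linprod (xs n)) (Suc k)) 
       - (\<Sum>i<k. coeff (linprod (xs n)) (Suc i) * psum (xs n) (k - Suc i))" for n
    proof -
      have "(\<Sum>i\<le>k. coeff (linprod (xs n)) i * psum (xs n) (k - i)) = 
         psum (xs n) k + (\<Sum>i<k. coeff (linprod (xs n)) (Suc i) * psum (xs n) (k - Suc i))"
        by (simp add: sum.atMost_shift coeff_linprod_0)
      then show ?thesis using newton_psum[of k "xs n"] by simp
    qed
    have "convergent (\<lambda>n. coeff (linprod (xs n)) j)" for j using coeff_lim convergentI by blast
    then show ?case unfolding eq using less
      by (intro convergent_diff convergent_mult convergent_sum convergent_const 
            convergent_minus_iff[THEN iffD1]) auto
  qed
  then show ?thesis unfolding kap_def by (simp add: convergent_LIMSEQ_iff)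
qed

lemma newton: "real (Suc n) * m (Suc n) = - (\<Sum>i\<le>n. m i * kap (n - i))"
proof (rule LIMSEQ_unique)
  show "(\<lambda>j. real (Suc n) * coeff (linprod (xs j)) (Suc n)) \<longlonglongrightarrow> real (Suc n) * m (Suc n)"
    by (intro tendsto_intros coeff_lim)
  show "(\<lambda>j. real (Suc n) * coeff (linprod (xs j)) (Suc n)) \<longlonglongrightarrow> - (\<Sum>i\<le>n. m i * kap (n - i))"
    unfolding newton_psum by (intro tendsto_intros coeff_lim psum_tendsto)
qed

lemma kap_0: "kap 0 = - m 1"
  using newton[of 0] by (simp add: m_0)

lemma kap_1: "kap 1 = (m 1)\<^sup>2 - 2 * m 2"
  using newton[of 1] by (simp add: m_0 kap_0 power2_eq_square numeral_2_eq_2)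

lemma kap_2: "kap 2 = - 3 * m 3 - m 1 * kap 1 - m 2 * kap 0"
  using newton[of 2] by (simp add: m_0 numeral_2_eq_2 numeral_3_eq_3)

text \<open>If the \<^term>\<open>kap k\<close> were geometric from index 1 on, \<^term>\<open>limfun\<close> would be
  \<open>(1 - X z)\<^sup>a e\<^sup>c\<^sup>z\<close>, whose coefficients do not decay fast enough.\<close>
lemma not_geometric:
  assumes "X > 0" and geo: "\<And>k. k \<ge> 1 \<Longrightarrow> kap (Suc k) = X * kap k"
  shows False
proof -
  define \<rho> where "\<rho> k = m (Suc k) / m k" for k
  have \<rho>0: "\<rho> k \<noteq> 0" for k using m_nonzero by (simp add: \<rho>_def)
  have l0: "\<rho> \<longlonglongrightarrow> 0" unfolding \<rho>_def by (rule ratio0)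
  have l1: "(\<lambda>k. real (Suc k) * \<rho> k) \<longlonglongrightarrow> 0" unfolding \<rho>_def by (rule ratio)
  have l2: "(\<lambda>k. real (Suc (Suc k)) * \<rho> (Suc k)) \<longlonglongrightarrow> 0" using LIMSEQ_Suc[OF l1] .
  \<comment> \<open>Newton's identity at \<open>Suc n\<close> minus \<open>X\<close> times the one
    at \<open>n\<close>. The terms with \<open>i < n\<close> cancel by \<open>geo\<close>; those
    involving \<open>kap 0\<close> survive, since \<open>geo\<close> starts at index 1.\<close>
  have rec: "real (Suc (Suc n)) * m (Suc (Suc n)) - X * (real (Suc n) * m (Suc n))
      = - kap 0 * m (Suc n) + (X * kap 0 - kap 1) * m n" for n
  proof -
    have "(\<Sum>i<n. m i * kap (Suc n - i)) = (\<Sum>i<n. X * (m i * kap (n - i)))"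
      by (intro sum.cong refl) (auto simp: Suc_diff_le geo)
    then show ?thesis unfolding newton
      by (simp add: lessThan_Suc_atMost[symmetric] sum_distrib_left[symmetric] algebra_simps)
  qed
  have rec': "real (Suc (Suc n)) * \<rho> (Suc n) * \<rho> n - X * (real (Suc n) * \<rho> n)
      = - kap 0 * \<rho> n + (X * kap 0 - kap 1)" for n
  proof -
    have "real (Suc (Suc n)) * \<rho> (Suc n) * \<rho> n - X * (real (Suc n) * \<rho> n) =
       (real (Suc (Suc n)) * m (Suc (Suc n)) - X * (real (Suc n) * m (Suc n))) / m n"
      using m_nonzero by (simp add: \<rho>_def diff_divide_distrib)
    also have "\<dots> = - kap 0 * \<rho> n + (X * kap 0 - kap 1)"
      unfolding rec using m_nonzero[of n] by (simp add: \<rho>_def field_simps)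
    finally show ?thesis .
  qed
  \<comment> \<open>In \<open>rec'\<close> every other term tends to 0, so this constant must
    vanish; then \<open>\<rho> n\<close> can be divided out.\<close>
  have "X * kap 0 - kap 1 = 0"
  proof (rule LIMSEQ_unique)
    have "(\<lambda>n. - kap 0 * \<rho> n + (X * kap 0 - kap 1)) \<longlonglongrightarrow> - kap 0 * 0 + (X * kap 0 - kap 1)"
      by (intro tendsto_intros l0)
    then show "(\<lambda>n. - kap 0 * \<rho> n + (X * kap 0 - kap 1)) \<longlonglongrightarrow> X * kap 0 - kap 1" by simp
    have "(\<lambda>n. real (Suc (Suc n)) * \<rho> (Suc n) * \<rho> n - X * (real (Suc n) * \<rho> n)) \<longlonglongrightarrow> 0 * 0 - X * 0"
      by (intro tendsto_intros l0 l1 l2)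
    then show "(\<lambda>n. - kap 0 * \<rho> n + (X * kap 0 - kap 1)) \<longlonglongrightarrow> 0" unfolding rec' by simp
  qed
  then have e0: "(real (Suc (Suc n)) * \<rho> (Suc n) - X * real (Suc n) + kap 0) * \<rho> n = 0" for n
    using rec'[of n] by (simp add: algebra_simps)
  then have e: "X * real (Suc n) = real (Suc (Suc n)) * \<rho> (Suc n) + kap 0" for n
  proof -
    have "real (Suc (Suc n)) * \<rho> (Suc n) - X * real (Suc n) + kap 0 = 0"
      using e0[of n] \<rho>0[of n] by (metis mult_eq_0_iff)
    then show ?thesis by linarith
  qed
  \<comment> \<open>Dividing \<open>e\<close> by \<open>Suc n\<close> makes the left side constantly
    \<open>X\<close> while the right side tends to 0.\<close>
  have "(\<lambda>n. real (Suc (Suc n)) * \<rho> (Suc n) + kap 0) \<longlonglongrightarrow> 0 + kap 0" by (intro tendsto_intros l2)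
  then have "(\<lambda>n. (real (Suc (Suc n)) * \<rho> (Suc n) + kap 0) * inverse (real (Suc n))) \<longlonglongrightarrow> (0 + kap 0) * 0" 
    by (intro tendsto_mult LIMSEQ_inverse_real_of_nat)
  moreover have "(real (Suc (Suc n)) * \<rho> (Suc n) + kap 0) * inverse (real (Suc n)) = X" for n
    unfolding e[symmetric] by (simp del: of_nat_Suc)
  ultimately show False using \<open>X > 0\<close> by (simp add: LIMSEQ_const_iff)
qed

text \<open>\<open>X\<close> is a limit point of the largest entries. The weak inequalities for the
  lists pass to the limit and become strict through \<open>not_geometric\<close>.\<close>

theorem smallest_root:
  assumes "kap 1 > 0"
  shows "\<exists>X>0. limfun (1 / X) = (0::real) \<and> (\<forall>t::real. 0 \<le> t \<and> t < 1 / X \<longrightarrow> limfun t > 0) \<and>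
    X < kap 0 \<and> kap 1 < X * kap 0 \<and> X\<^sup>2 < kap 1 \<and> kap 2 < X * kap 1 \<and> 0 < kap 2"
proof -
  define x where "x n = Max (set (xs n))" for n
  have x_in: "x n \<in> set (xs n)" for n unfolding x_def using xs_nonempty by (intro Max_in) auto
  have x_max: "y \<le> x n" if "y \<in> set (xs n)" for y n unfolding x_def using that by (intro Max_ge) auto
  have x_pos: "x n > 0" for n using x_in xs_pos by auto
  \<comment> \<open>The largest entry is at most the first power sum, hence bounded, and
    Bolzano-Weierstrass yields \<open>X\<close>.\<close>
  obtain C where C: "\<And>n. psum (xs n) 0 \<le> C"
    using convergent_imp_Bseq[OF convergentI[OF psum_tendsto[of 0]]] by (auto simp: Bseq_def abs_le_iff)
  have "x n \<in> {0..C}" for n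
  proof -
    have "x n ^ Suc 0 \<le> psum (xs n) 0" using xs_pos x_in by (rule power_le_psum)
    then show ?thesis using C[of n] x_pos[of n] by auto
  qed
  then obtain X r where r: "strict_mono r" and lx: "(x \<circ> r) \<longlonglongrightarrow> X"
    using seq_compactE[OF compact_imp_seq_compact[OF compact_Icc[of 0 C]], of x] by metis
  have lx: "(\<lambda>n. x (r n)) \<longlonglongrightarrow> X" using lx by (simp add: o_def)
  have lk: "(\<lambda>n. psum (xs (r n)) k) \<longlonglongrightarrow> kap k" for k
    using LIMSEQ_subseq_LIMSEQ[OF psum_tendsto r] by (simp add: o_def)
  have X0: "X \<ge> 0" by (rule LIMSEQ_le_const[OF lx]) (use x_pos less_imp_le in blast)
  have le: "kap (Suc k) \<le> X * kap k" for k
    by (rule LIMSEQ_le[OF lk tendsto_mult[OF lx lk]]) (auto intro!: psum_Suc_le xs_pos x_max)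
  have pw: "X ^ Suc k \<le> kap k" for k
    by (rule LIMSEQ_le[OF tendsto_power[OF lx] lk]) (intro exI allI impI power_le_psum xs_pos x_in)
  have quad: "2 * X * kap (Suc k) - X\<^sup>2 * kap k \<le> kap (Suc (Suc k))" for k
  proof (rule LIMSEQ_le)
    show "(\<lambda>n. 2 * X * psum (xs (r n)) (Suc k) - X\<^sup>2 * psum (xs (r n)) k) \<longlonglongrightarrow> 2 * X * kap (Suc k) - X\<^sup>2 * kap k"
      by (intro tendsto_intros lk)
  qed (rule lk, intro exI allI impI psum_quadratic xs_pos)
  have X: "X > 0" using X0 le[of 0] assms by (cases "X = 0") auto
  \<comment> \<open>Under this equality the lower bound in \<open>quad\<close> simplifies to
    \<open>X * kap (Suc k)\<close>, which is also the upper bound in \<open>le\<close>.\<close>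
  have step: "kap (Suc (Suc k)) = X * kap (Suc k)" if "kap (Suc k) = X * kap k" for k
    using le[of "Suc k"] quad[of k] that by (simp add: power2_eq_square)
  \<comment> \<open>Equality at \<open>k\<close> persists for all larger indices;
    \<open>k \<le> 1\<close> ensures that it covers every index from 1 on, as
    \<open>not_geometric\<close> demands.\<close>
  have strict: "kap (Suc k) < X * kap k" if "k \<le> 1" for k
  proof (rule ccontr)
    assume "\<not> kap (Suc k) < X * kap k"
    then have eq: "kap (Suc k) = X * kap k" using le[of k] by simp
    have "kap (Suc j) = X * kap j" if "k \<le> j" for j
      using that by (induction j rule: dec_induct) (rule eq, erule step)
    then show False using not_geometric[OF X] \<open>k \<le> 1\<close> by simp
  qed
  \<comment> \<open>Equality would give \<open>X^2 \<le> kap 1 < X * kap 0 = X^2\<close>;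
    \<open>s1\<close> is analogous one index higher.\<close>
  have s0: "X < kap 0" using pw[of 0] pw[of 1] strict[of 0] 
    by (cases "X = kap 0") (auto simp: power2_eq_square)
  have s1: "X\<^sup>2 < kap 1" using pw[of 1] pw[of 2] strict[of 1]
    by (cases "X\<^sup>2 = kap 1") (auto simp: power2_eq_square eval_nat_numeral)
  have "(\<lambda>n. 1 / x (r n)) \<longlonglongrightarrow> 1 / X" using X by (intro tendsto_intros lx) auto
  from evalp_tendsto[OF r this] have "(\<lambda>n. evalp (linprod (xs (r n))) (1 / x (r n))) \<longlonglongrightarrow> limfun (1 / X)" .
  moreover have "evalp (linprod (xs (r n))) (1 / x (r n)) = 0" for n
    unfolding evalp_linprod using x_in[of "r n"] x_pos[of "r n"] by (force simp: prod_list_zero_iff)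
  ultimately have root: "limfun (1 / X) = (0::real)" by (simp add: LIMSEQ_const_iff)
  have "limfun t > 0" if t: "0 \<le> t" "t < 1 / X" for t :: real
  proof -
    \<comment> \<open>The midpoint of \<open>t * X\<close> and 1: along the subsequence all products
      \<open>t * y\<close> with list entries \<open>y\<close> are eventually below \<open>c\<close>,
      a bound independent of \<open>n\<close>.\<close>
    define c where "c = (t * X + 1) / 2"
    have c: "t * X < c" "c < 1" using t X by (auto simp: c_def field_simps)
    have "(\<lambda>n. t * x (r n)) \<longlonglongrightarrow> t * X" by (intro tendsto_intros lx)
    then have ev: "eventually (\<lambda>n. t * x (r n) < c) sequentially" using c by (intro order_tendstoD(2))
    have "(\<lambda>n. evalp (linprod (xs (r n))) t) \<longlonglongrightarrow> limfun t"
      by (rule evalp_tendsto[OF r tendsto_const])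
    then have "exp (- (t * kap 0 / (1 - c))) \<le> limfun t"
    proof (rule tendsto_le[OF sequentially_bot])
      show "(\<lambda>n. exp (- (t * psum (xs (r n)) 0 / (1 - c)))) \<longlonglongrightarrow> exp (- (t * kap 0 / (1 - c)))"
        using c by (intro tendsto_intros lk) auto
      show "eventually (\<lambda>n. exp (- (t * psum (xs (r n)) 0 / (1 - c))) \<le> evalp (linprod (xs (r n))) t) sequentially"
        using ev
      proof eventually_elim
        case (elim n)
        have "t * y \<le> c" if "y \<in> set (xs (r n))" for y
          using mult_left_mono[OF x_max[OF that] t(1)] elim by simp
        then have "exp (- (t * psum (xs (r n)) 0 / (1 - c))) \<le> poly (linprod (xs (r n))) t"
          using t(1) c(2) xs_pos by (intro linprod_ge_exp) auto
        then show ?case by simp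
      qed
    qed
    then show ?thesis using exp_gt_zero less_le_trans by blast
  qed
  moreover have "0 < kap 2" using pw[of 2] X by (intro less_le_trans[OF zero_less_power pw])
  ultimately show ?thesis using X root s0 s1 strict[of 0] strict[of 1]
    by (intro exI[of _ X]) (auto simp: numeral_2_eq_2)
qed

end

section \<open>The \<open>q\<close>-Laguerre approximants\<close>

text \<open>For \<open>t \<le> 0\<close> all terms are nonnegative and the constant one is 1. This
  excludes roots that are negative or zero.\<close>

lemma poly_alternating_ge_1:
  fixes p :: "real poly"
  assumes "\<And>k. (-1) ^ k * coeff p k \<ge> 0" "coeff p 0 = 1" "t \<le> 0"
  shows "poly p t \<ge> 1"
proof -
  have "0 \<le> coeff p k * t ^ k" for k
  proof -
    have "(-1) ^ k * (- t) ^ k = t ^ k" by (simp flip: power_mult_distrib)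
    then have "coeff p k * t ^ k = ((-1) ^ k * coeff p k) * (- t) ^ k" by (simp add: mult_ac)
    then show ?thesis using assms(1)[of k] assms(3) by (simp only: mult_nonneg_nonneg zero_le_power neg_0_le_iff_le)
  qed
  then have "coeff p 0 * t ^ 0 \<le> (\<Sum>k\<le>degree p. coeff p k * t ^ k)"
    by (intro member_le_sum) auto
  then show ?thesis using assms(2) by (simp add: poly_altdef)
qed

text \<open>The coefficients \<open>a k = (-1)\<^sup>k q\<^bsup>k(k-1)\<^esup> (b/4)\<^sup>k / ((q;q)\<^sub>k (b;q)\<^sub>k)\<close> with \<open>b = q\<^bsup>\<nu>+1\<^esup>\<close>.\<close>
locale qbessel =
  fixes q b :: real and a :: "nat \<Rightarrow> real"
  assumes q: "0 < q" "q < 1" and b: "0 < b" "b < 1"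
    and a_0: "a 0 = 1"
    and a_Suc: "\<And>n. a (Suc n) = - a n * (q ^ (2 * n) * (b / 4) / ((1 - q ^ Suc n) * (1 - b * q ^ n)))"
begin

text \<open>For \<open>k \<le> n\<close> this is \<open>(q;q)\<^sub>n / (q;q)\<^sub>n\<^sub>-\<^sub>k\<close>; for \<open>k > n\<close> it is 0 because truncated subtraction
  produces a factor \<open>1 - q\<^sup>0\<close>.\<close>
definition L :: "nat \<Rightarrow> nat \<Rightarrow> real" where
  "L n k = (\<Prod>j<k. 1 - q ^ (n - j))"

text \<open>Up to normalization and scaling, the \<open>q\<close>-Laguerre polynomials.\<close>
definition P :: "nat \<Rightarrow> real poly" where
  "P n = (\<Sum>k\<le>n. monom (L n k * a k) k)"

definition G :: "nat \<Rightarrow> real poly" where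
  "G n = pderiv (pCons 0 (P n))"

lemma qpow_lt_1: "q ^ Suc n < 1" 
  using q by (intro power_Suc_less_one) auto

lemma qpow_le_1: "q ^ n \<le> 1"
  using q by (simp add: power_le_one)

lemma bq_lt_1: "b * q ^ n < 1"
  using b q mult_left_mono[OF qpow_le_1[of n], of b] by linarith

lemma L_0 [simp]: "L n 0 = 1"
  by (simp add: L_def)

lemma L_Suc: "L n (Suc k) = L n k * (1 - q ^ (n - k))"
  by (simp add: L_def)

lemma L_Suc_Suc: "L (Suc n) (Suc k) = (1 - q ^ Suc n) * L n k"
  unfolding L_def by (subst prod.lessThan_Suc_shift) simp

lemma L_eq_0: "n < k \<Longrightarrow> L n k = 0"
  unfolding L_def by (intro prod_zero) (auto intro!: bexI[of _ n])

lemma L_bounds: "0 \<le> L n k \<and> L n k \<le> 1"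
proof (induction k)
  case (Suc k)
  have "0 \<le> 1 - q ^ (n - k)" "1 - q ^ (n - k) \<le> 1" using qpow_le_1 q by auto
  then show ?case using Suc unfolding L_Suc by (auto intro: mult_le_one)
qed simp

lemma L_tendsto: "(\<lambda>n. L n k) \<longlonglongrightarrow> 1"
proof -
  have "(\<lambda>n. q ^ n) \<longlonglongrightarrow> 0" using q by (intro LIMSEQ_power_zero) auto
  then have "(\<lambda>n. q ^ (n - j)) \<longlonglongrightarrow> 0" for j
    using LIMSEQ_offset[of "\<lambda>n. q ^ (n - j)" j] by simp
  then have "(\<lambda>n. \<Prod>j<k. 1 - q ^ (n - j)) \<longlonglongrightarrow> (\<Prod>j<k. 1 - 0)" by (intro tendsto_intros)
  then show ?thesis by (simp add: L_def)
qed

lemma coeff_P: "coeff (P n) k = L n k * a k"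
  by (auto simp: P_def coeff_sum coeff_monom L_eq_0)

lemma coeff_G: "coeff (G n) k = real (Suc k) * (L n k * a k)"
  by (simp add: G_def coeff_pderiv coeff_P)

lemma a_sign: "(-1) ^ k * a k > 0"
proof (induction k)
  case (Suc k)
  have "q ^ (2 * k) * (b / 4) / ((1 - q ^ Suc k) * (1 - b * q ^ k)) > 0"
    using q b qpow_lt_1[of k] bq_lt_1[of k] by (intro divide_pos_pos mult_pos_pos) auto
  from mult_pos_pos[OF Suc this] show ?case unfolding a_Suc by (simp only: power_Suc mult_minus1 mult_minus_left mult_minus_right minus_minus mult.assoc)
qed (simp add: a_0)

lemma a_nonzero: "a k \<noteq> 0"
  using a_sign[of k] by auto

text \<open>Comparison of coefficients: all \<open>L\<close> factors are expressed through
  \<open>M\<close> and the \<open>a\<close> factors are linked by \<open>a_Suc\<close>, which leaves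
  the polynomial identity \<open>main\<close>.\<close>

lemma P_rec:
  "smult (1 - b * q ^ Suc n) (P (Suc (Suc n))) =
   [:(1 - b * q ^ Suc n) + q * (1 - q ^ Suc n), - (q ^ (2 * Suc n) * (b / 4)):] * P (Suc n)
   - smult (q * (1 - q ^ Suc n)) (P n)"
proof (rule poly_eqI)
  fix k
  show "coeff (smult (1 - b * q ^ Suc n) (P (Suc (Suc n)))) k =
     coeff ([:(1 - b * q ^ Suc n) + q * (1 - q ^ Suc n), - (q ^ (2 * Suc n) * (b / 4)):] * P (Suc n)
     - smult (q * (1 - q ^ Suc n)) (P n)) k"
  proof (cases k)
    case 0
    then show ?thesis by (simp add: coeff_P coeff_mult algebra_simps)
  next
    case (Suc j)
    define M where "M = L (Suc n) j"
    define A where "A = a (Suc j)"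
    define v where "v = q ^ j"
    define Q where "Q = q ^ Suc n"
    have Lb: "(1 - Q) * L n (Suc j) = M * (1 - q ^ (Suc n - j)) * (1 - q ^ (Suc n - Suc j))"
      unfolding Q_def M_def L_Suc_Suc[symmetric] by (simp add: L_Suc)
    have "(1 - q ^ Suc j) * (1 - b * q ^ j) \<noteq> 0" using qpow_lt_1[of j] bq_lt_1[of j] by auto
    then have aj: "v\<^sup>2 * (b / 4) * a j = - A * ((1 - q * v) * (1 - b * v))"
      unfolding A_def a_Suc v_def by (simp add: field_simps power_mult power2_eq_square power_mult_distrib)
    have main: "(1 - b * Q) * ((1 - q * Q) * M * A) =
        ((1 - b * Q) + q * (1 - Q)) * (M * (1 - q ^ (Suc n - j)) * A) - Q\<^sup>2 * (b / 4) * (M * a j)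
        - q * (M * (1 - q ^ (Suc n - j)) * (1 - q ^ (Suc n - Suc j))) * A"
    proof -
      \<comment> \<open>Truncated subtraction separates the cases: for \<open>j = Suc n\<close> the
        factor \<open>1 - q ^ (Suc n - j)\<close> is 0, and for larger \<open>j\<close> already
        \<open>M\<close> is 0.\<close>
      consider "j \<le> n" | "j = Suc n" | "j > Suc n" by linarith
      then show ?thesis
      proof cases
        case 1
        define u where "u = q ^ (n - j)"
        have e: "q ^ (Suc n - j) = q * u" "q ^ (Suc n - Suc j) = u" "Q = q * u * v"
          using 1 by (simp_all add: u_def v_def Q_def Suc_diff_le flip: power_add)
        have "Q\<^sup>2 * (b / 4) * (M * a j) = q\<^sup>2 * u\<^sup>2 * M * (v\<^sup>2 * (b / 4) * a j)"
          unfolding e by (simp add: power_mult_distrib)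
        also have "\<dots> = - q\<^sup>2 * u\<^sup>2 * M * A * ((1 - q * v) * (1 - b * v))" unfolding aj by simp
        finally have h: "Q\<^sup>2 * (b / 4) * (M * a j) = - q\<^sup>2 * u\<^sup>2 * M * A * ((1 - q * v) * (1 - b * v))" .
        show ?thesis unfolding h unfolding e by (simp add: power2_eq_square algebra_simps)
      next
        case 2
        then have "Q = v" by (simp add: Q_def v_def)
        have "Q\<^sup>2 * (b / 4) * (M * a j) = M * (v\<^sup>2 * (b / 4) * a j)"
          unfolding \<open>Q = v\<close> by simp
        then show ?thesis unfolding aj \<open>Q = v\<close> using 2 by simp
      next
        case 3
        then show ?thesis by (simp add: M_def L_eq_0)
      qed
    qed
    have "coeff (smult (1 - b * q ^ Suc n) (P (Suc (Suc n)))) k = (1 - b * Q) * ((1 - q * Q) * M * A)"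
      unfolding Suc by (simp add: coeff_P L_Suc_Suc M_def A_def Q_def)
    moreover have "coeff ([:(1 - b * q ^ Suc n) + q * (1 - q ^ Suc n), - (q ^ (2 * Suc n) * (b / 4)):] * P (Suc n)
        - smult (q * (1 - q ^ Suc n)) (P n)) k = ((1 - b * Q) + q * (1 - Q)) * (L (Suc n) (Suc j) * A) - Q\<^sup>2 * (b / 4) * (M * a j)
        - q * ((1 - Q) * L n (Suc j)) * A"
      unfolding Suc
      by (simp add: coeff_P M_def A_def Q_def mult.assoc power_mult[symmetric] power2_eq_square power_add[symmetric] mult_2)
    moreover have "L (Suc n) (Suc j) = M * (1 - q ^ (Suc n - j))" by (simp add: L_Suc M_def)
    ultimately show ?thesis using main Lb by (simp only:)
  qed
qed

lemma P_0: "P 0 = 1"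
  by (simp add: P_def a_0)

text \<open>By the recurrence the ratio \<open>w\<close> is replaced by
  \<open>(c + d - e z - d / w) / c\<close> with positive \<open>c\<close>, \<open>d\<close>,
  \<open>e\<close>, which keeps it in the lower half-plane. Nonvanishing comes along, since a zero
  of \<open>P (Suc n)\<close> would make \<open>w\<close> equal to 0.\<close>

lemma P_upper:
  assumes "Im z > 0"
  shows "evalp (P n) z \<noteq> 0 \<and> Im (evalp (P (Suc n)) z / evalp (P n) z) < 0"
proof (induction n)
  case 0
  have "P (Suc 0) = [:1, L 1 1 * a 1:]" by (simp add: P_def a_0 monom_altdef)
  moreover have "L 1 1 > 0" "a 1 < 0" using a_sign[of 1] q by (auto simp: L_def)
  ultimately show ?case using assms by (simp add: P_0 mult_pos_neg mult_neg_pos)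
next
  case (Suc n)
  define w where "w = evalp (P (Suc n)) z / evalp (P n) z"
  have w: "Im w < 0" "evalp (P n) z \<noteq> 0" using Suc by (auto simp: w_def)
  have nz: "evalp (P (Suc n)) z \<noteq> 0" using w(1) by (auto simp: w_def)
  define c where "c = 1 - b * q ^ Suc n"
  define d where "d = q * (1 - q ^ Suc n)"
  define e where "e = q ^ (2 * Suc n) * (b / 4)"
  have c: "c > 0" using bq_lt_1 unfolding c_def by (simp del: power_Suc)
  have d: "d > 0" using qpow_lt_1[of n] q unfolding d_def by (intro mult_pos_pos) auto
  have e: "e > 0" using q b unfolding e_def by simp
  have "evalp (smult c (P (Suc (Suc n)))) z = evalp ([:c + d, - e:] * P (Suc n) + smult (- d) (P n)) z"
    using P_rec[of n] by (simp only: c_def d_def e_def smult_minus_left add_uminus_conv_diff)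
  then have "of_real c * evalp (P (Suc (Suc n))) z = (of_real (c + d) - of_real e * z) * evalp (P (Suc n)) z - of_real d * evalp (P n) z"
    by (simp only: evalp_smult evalp_add evalp_mult) simp
  then have "of_real c * (evalp (P (Suc (Suc n))) z / evalp (P (Suc n)) z) = of_real (c + d) - of_real e * z - of_real d * inverse w"
    using nz w(2) by (simp add: w_def field_simps)
  then have "Im (of_real c * (evalp (P (Suc (Suc n))) z / evalp (P (Suc n)) z)) = Im (of_real (c + d) - of_real e * z - of_real d * inverse w)"
    by (rule arg_cong)
  then have "c * Im (evalp (P (Suc (Suc n))) z / evalp (P (Suc n)) z) = - e * Im z - d * Im (inverse w)"
    by (simp only: Im_complex_of_real minus_complex.sel times_complex.sel Re_complex_of_real)
  moreover have "Im (inverse w) > 0"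
  proof -
    have "(Re w)\<^sup>2 + (Im w)\<^sup>2 > 0" using w(1) by (intro add_nonneg_pos) auto
    then show ?thesis using w(1) by (simp add: divide_neg_pos)
  qed
  ultimately have "c * Im (evalp (P (Suc (Suc n))) z / evalp (P (Suc n)) z) < 0"
    using mult_pos_pos[OF e assms] mult_pos_pos[OF d, of "Im (inverse w)"] by linarith
  then show ?case using nz c by (simp add: mult_less_0_iff)
qed

text \<open>\<open>P_upper\<close> excludes the upper half-plane, conjugation the lower one, and the
  alternating signs the rest of the real axis.\<close>

lemma P_root:
  assumes "evalp (P n) z = 0"
  shows "Im z = 0 \<and> Re z > 0"
proof -
  have im: "Im z = 0"
  proof (rule ccontr)
    assume "Im z \<noteq> 0"
    then consider "Im z > 0" | "Im (cnj z) > 0" by fastforce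
    then show False using P_upper[of z n] P_upper[of "cnj z" n] assms by cases (auto simp: evalp_cnj)
  qed
  then have "z = of_real (Re z)" by (simp add: complex_eq_iff)
  then have "poly (P n) (Re z) = 0" using assms by (metis evalp_of_real of_real_eq_0_iff)
  moreover have "0 \<le> (-1) ^ k * coeff (P n) k" for k
    unfolding coeff_P mult.left_commute[of _ "L n k"]
    by (rule mult_nonneg_nonneg[OF L_bounds[THEN conjunct1] less_imp_le[OF a_sign]])
  ultimately have "\<not> Re z \<le> 0" using poly_alternating_ge_1[of "P n" "Re z"] by (auto simp: coeff_P a_0)
  then show ?thesis using im by simp
qed

lemma P_linprod: "\<exists>xs. (\<forall>x\<in>set xs. x > 0) \<and> P n = linprod xs"
  by (rule real_rooted_imp_linprod) (use P_root in \<open>auto simp: coeff_P a_0\<close>)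

lemma G_root:
  assumes "evalp (G n) z = 0"
  shows "Im z = 0 \<and> Re z > 0"
proof -
  obtain xs where xs: "\<forall>x\<in>set xs. x > 0" "P n = linprod xs" using P_linprod by blast
  have im: "Im z = 0" using pderiv_linprod_nonreal[of xs z] xs assms by (auto simp: G_def)
  then have "z = of_real (Re z)" by (simp add: complex_eq_iff)
  then have "poly (G n) (Re z) = 0" using assms by (metis evalp_of_real of_real_eq_0_iff)
  moreover have "0 \<le> (-1) ^ k * coeff (G n) k" for k
  proof -
    have "0 \<le> real (Suc k) * L n k * ((-1) ^ k * a k)"
      using L_bounds[of n k] by (intro mult_nonneg_nonneg[OF _ less_imp_le[OF a_sign]]) simp
    then show ?thesis unfolding coeff_G by (simp only: mult_ac)
  qed
  ultimately have "\<not> Re z \<le> 0" using poly_alternating_ge_1[of "G n" "Re z"] by (auto simp: coeff_G a_0)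
  then show ?thesis using im by simp
qed

lemma G_linprod: "\<exists>xs. (\<forall>x\<in>set xs. x > 0) \<and> G n = linprod xs"
  by (rule real_rooted_imp_linprod) (use G_root in \<open>auto simp: coeff_G a_0\<close>)

section \<open>Convergence of the approximants\<close>

lemma a_ratio: "(\<lambda>k. real (Suc k) * (a (Suc k) / a k)) \<longlonglongrightarrow> 0"
proof -
  have q2: "norm (q ^ 2) < 1" using q by (simp add: power_less_one_iff abs_square_less_1)
  have l: "(\<lambda>k. q ^ k) \<longlonglongrightarrow> 0" using q by (intro LIMSEQ_power_zero) auto
  have "(\<lambda>k. - ((real k * (q\<^sup>2) ^ k + (q\<^sup>2) ^ k) * (b / 4) / ((1 - q * q ^ k) * (1 - b * q ^ k)))) \<longlonglongrightarrow>
     - ((0 + 0) * (b / 4) / ((1 - q * 0) * (1 - b * 0)))"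
    by (intro tendsto_intros powser_times_n_limit_0 q2 l LIMSEQ_power_zero) auto
  moreover have "real (Suc k) * (a (Suc k) / a k) = - ((real k * (q\<^sup>2) ^ k + (q\<^sup>2) ^ k) * (b / 4) / ((1 - q * q ^ k) * (1 - b * q ^ k)))" for k
    using a_nonzero[of k] unfolding a_Suc by (simp add: power_mult distrib_right)
  ultimately show ?thesis by simp
qed

text \<open>For the coefficients \<open>hcoef\<close>, \<open>F.limfun\<close> is
  \<open>h(z)/z\<close>, and \<open>G.limfun\<close> below is \<open>h'\<close>.\<close>

sublocale F: poly_limit P a
proof
  show "(\<lambda>n. coeff (P n) k) \<longlonglongrightarrow> a k" for k
    using tendsto_mult[OF L_tendsto[of k] tendsto_const[of "a k"]] by (simp add: coeff_P)
  show "\<bar>coeff (P n) k\<bar> \<le> \<bar>a k\<bar>" for n k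
    using L_bounds[of n k] by (simp add: coeff_P abs_mult mult_left_le_one_le)
qed (fact a_nonzero a_ratio)+

abbreviation m :: "nat \<Rightarrow> real" where "m k \<equiv> real (Suc k) * a k"

lemma m_ratio: "(\<lambda>k. real (Suc k) * (m (Suc k) / m k)) \<longlonglongrightarrow> 0"
proof -
  have "(\<lambda>k. real (Suc k) * (a (Suc k) / a k) + a (Suc k) / a k) \<longlonglongrightarrow> 0 + 0"
    by (intro tendsto_add a_ratio F.ratio0)
  moreover have "real (Suc k) * (m (Suc k) / m k) = real (Suc k) * (a (Suc k) / a k) + a (Suc k) / a k" for k
  proof -
    have "real (Suc k) * (m (Suc k) / m k) = real (Suc (Suc k)) * (a (Suc k) / a k)"
      by (simp del: of_nat_Suc)
    moreover have "real (Suc (Suc k)) * x = real (Suc k) * x + x" for x by (simp add: algebra_simps)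
    ultimately show ?thesis by (simp only:)
  qed
  ultimately show ?thesis by simp
qed

sublocale G: poly_limit G m
proof
  show "(\<lambda>n. coeff (G n) k) \<longlonglongrightarrow> m k" for k
    using tendsto_mult[OF tendsto_const[of "real (Suc k)"] tendsto_mult[OF L_tendsto[of k] tendsto_const[of "a k"]]] 
    by (simp only: coeff_G mult_1_left)
  show "\<bar>coeff (G n) k\<bar> \<le> \<bar>m k\<bar>" for n k
    using L_bounds[of n k] by (simp add: coeff_G abs_mult mult_left_le_one_le mult_left_mono)
  show "m k \<noteq> 0" for k using a_nonzero by simp
qed (fact m_ratio)

end

section \<open>Starlikeness and the Jackson \<open>q\<close>-Bessel function\<close>

context qbessel
begin

text \<open>\<open>K0\<close>, \<open>K1\<close>, \<open>K2\<close> are the first three limiting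
  power sums of the reciprocal roots, written in the coefficients of \<open>h'\<close> by Newton's
  identities.\<close>

lemma smallest_root:
  defines "K0 \<equiv> - m 1" and "K1 \<equiv> (m 1)\<^sup>2 - 2 * m 2"
  defines "K2 \<equiv> - 3 * m 3 - m 1 * K1 - m 2 * K0"
  assumes "K1 > 0"
  shows "\<exists>X>0. G.limfun (1 / X) = (0::real) \<and> (\<forall>t::real. 0 \<le> t \<and> t < 1 / X \<longrightarrow> G.limfun t > 0) \<and>
    X < K0 \<and> K1 < X * K0 \<and> X\<^sup>2 < K1 \<and> K2 < X * K1 \<and> 0 < K2"
proof -
  \<comment> \<open>The index starts at 1 because \<open>G 0\<close> is constant and its list would
    be empty.\<close>
  have "\<forall>n. \<exists>xs. (\<forall>x\<in>set xs. x > 0) \<and> G (Suc n) = linprod xs" using G_linprod by blast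
  then obtain xs where xs: "\<And>n. (\<forall>x\<in>set (xs n). x > 0) \<and> G (Suc n) = linprod (xs n)"
    by metis
  have ne: "xs n \<noteq> []" for n
  proof
    assume "xs n = []"
    then have "coeff (G (Suc n)) 1 = 0" using xs[of n] by simp
    moreover have "L (Suc n) 1 \<noteq> 0" using qpow_lt_1[of n] by (simp add: L_def)
    ultimately show False using a_nonzero by (simp add: coeff_G)
  qed
  interpret R: real_rooted_limit xs m
  proof
    show "(\<lambda>n. coeff (linprod (xs n)) k) \<longlonglongrightarrow> m k" for k
      using LIMSEQ_Suc[OF G.coeff_lim[of k]] xs by simp
    show "\<bar>coeff (linprod (xs n)) k\<bar> \<le> \<bar>m k\<bar>" for n k
      using G.coeff_le[of "Suc n" k] xs by simp
  qed (use xs ne G.m_nonzero G.ratio in auto)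
  have K: "R.kap 0 = K0" "R.kap 1 = K1" "R.kap 2 = K2"
    by (simp_all only: R.kap_0 R.kap_1 R.kap_2 K0_def K1_def K2_def)
  show ?thesis using R.smallest_root assms(4) unfolding K by blast
qed

text \<open>Termwise differentiation of an everywhere convergent power series; \<open>c\<close> is
  the coefficient sequence shifted by the factor \<open>z\<close>.\<close>

lemma H_deriv:
  "((\<lambda>z::'a::{real_normed_field,banach}. z * F.limfun z) has_field_derivative G.limfun z) (at z)"
proof -
  define c :: "nat \<Rightarrow> 'a" where "c n = (case n of 0 \<Rightarrow> 0 | Suc k \<Rightarrow> of_real (a k))" for n
  have s: "summable (\<lambda>n. c (Suc n) * y ^ n)" for y using F.summable_limfun[of y] by (simp add: c_def)
  have s': "summable (\<lambda>n. c n * y ^ n)" for y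
  proof -
    have "summable (\<lambda>n. c (Suc n) * y ^ Suc n)" using summable_mult[OF s[of y], of y] by (simp add: mult_ac)
    then show ?thesis by (subst (asm) summable_Suc_iff[of "\<lambda>n. c n * y ^ n"])
  qed
  have "(\<Sum>n. c n * y ^ n) = y * F.limfun y" for y
  proof -
    have "(\<Sum>n. c n * y ^ n) = (\<Sum>n. y * (c (Suc n) * y ^ n))"
      using suminf_split_head[OF s', of y] by (simp add: c_def mult_ac)
    also have "\<dots> = y * F.limfun y" using suminf_mult[OF s, of y y] by (simp add: c_def F.limfun_def)
    finally show ?thesis .
  qed
  moreover have "(\<Sum>n. diffs c n * z ^ n) = G.limfun z"
    unfolding G.limfun_def by (simp add: diffs_def c_def)
  ultimately show ?thesis using termdiffs_strong_converges_everywhere[of c z, OF s'] by (simp only:)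
qed

text \<open>\<open>z * F.limfun z\<close> vanishes at 0 and has positive derivative on
  \<open>[0, t]\<close>, hence is positive at \<open>t > 0\<close>.\<close>

lemma F_pos:
  fixes t :: real
  assumes "\<And>s::real. 0 \<le> s \<Longrightarrow> s \<le> t \<Longrightarrow> G.limfun s > 0" "0 \<le> t"
  shows "F.limfun t > 0"
proof (cases "t = 0")
  case True
  then show ?thesis by (simp add: F.limfun_def a_0)
next
  case False
  have "\<exists>y. ((\<lambda>z::real. z * F.limfun z) has_real_derivative y) (at x) \<and> 0 < y" if "0 \<le> x" "x \<le> t" for x
    using H_deriv[of x] assms(1)[OF that] by blast
  then have "0 * F.limfun 0 < t * F.limfun t"
    using False assms(2) by (intro DERIV_pos_imp_increasing[of 0 t "\<lambda>z. z * F.limfun z"]) auto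
  then show ?thesis using False assms(2) by (simp add: zero_less_mult_iff)
qed

text \<open>Since \<open>F.limfun\<close> has no zero on \<open>[0, r]\<close>, neither has
  \<open>P n\<close> eventually, so \<open>linprod_starlike\<close> applies to it. Its inequality
  passes to the limit, where the bound is a quotient of positive numbers.\<close>

lemma starlike_inside:
  fixes z :: complex
  assumes pos: "\<And>s::real. 0 \<le> s \<Longrightarrow> s \<le> cmod z \<Longrightarrow> G.limfun s > 0" and "z \<noteq> 0"
  shows "Re (z * G.limfun z / (z * F.limfun z)) > 0"
proof -
  define r where "r = cmod z"
  have Fp: "F.limfun s > 0" if "0 \<le> s" "s \<le> r" for s :: real
    using that pos by (intro F_pos) (auto simp: r_def)
  have Fr: "F.limfun r > 0" "G.limfun r > 0" using Fp[of r] pos[of r] by (auto simp: r_def)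
  have "eventually (\<lambda>n. \<forall>t. 0 \<le> t \<and> t \<le> r \<longrightarrow> poly (P n) t \<noteq> 0) sequentially"
    using Fp by (intro F.eventually_no_root) force
  then have ev: "eventually (\<lambda>n. poly (G n) r / poly (P n) r \<le> Re (evalp (G n) z / evalp (P n) z)
      \<and> poly (P n) r \<le> cmod (evalp (P n) z)) sequentially"
  proof eventually_elim
    case (elim n)
    obtain xs where xs: "\<forall>x\<in>set xs. x > 0" "P n = linprod xs" using P_linprod by blast
    have "x * cmod z < 1" if x: "x \<in> set xs" for x
    proof (rule ccontr)
      assume "\<not> x * cmod z < 1"
      moreover have "x > 0" using xs x by auto
      ultimately have "0 \<le> 1 / x" "1 / x \<le> r" by (auto simp: r_def field_simps)
      moreover have "poly (P n) (1 / x) = 0"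
        using evalp_linprod[of xs "1/x"] x \<open>x > 0\<close> by (force simp: xs(2) prod_list_zero_iff)
      ultimately show False using elim by blast
    qed
    then show ?case using linprod_starlike[of xs z] xs by (simp add: G_def r_def)
  qed
  have lim: "(\<lambda>n. evalp (P n) w) \<longlonglongrightarrow> F.limfun w" "(\<lambda>n. evalp (G n) w) \<longlonglongrightarrow> G.limfun w"
    for w :: "'b::{real_normed_field,banach}"
    using F.evalp_tendsto[OF strict_mono_id tendsto_const] G.evalp_tendsto[OF strict_mono_id tendsto_const] by auto
  have lr: "(\<lambda>n. poly (P n) r) \<longlonglongrightarrow> F.limfun r" "(\<lambda>n. poly (G n) r) \<longlonglongrightarrow> G.limfun r"
    using lim[of r] by simp_all
  have "F.limfun r \<le> cmod (F.limfun z)"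
    by (rule tendsto_le[OF sequentially_bot tendsto_norm[OF lim(1)] lr(1)]) (use ev in eventually_elim, auto)
  then have Fz: "F.limfun z \<noteq> 0" using Fr by auto
  have "G.limfun r / F.limfun r \<le> Re (G.limfun z / F.limfun z)"
  proof (rule tendsto_le[OF sequentially_bot])
    show "(\<lambda>n. Re (evalp (G n) z / evalp (P n) z)) \<longlonglongrightarrow> Re (G.limfun z / F.limfun z)"
      using Fz by (intro tendsto_intros lim)
    show "(\<lambda>n. poly (G n) r / poly (P n) r) \<longlonglongrightarrow> G.limfun r / F.limfun r"
      using Fr by (intro tendsto_intros lr) auto
  qed (use ev in eventually_elim, auto)
  moreover have "G.limfun r / F.limfun r > 0" using Fr by simp
  ultimately show ?thesis using assms(2) by simp
qed

text \<open>Maximality is tested at the point \<open>z = R\<close> itself: \<open>h'\<close>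
  vanishes there, so the real part is 0 and no larger disc is admissible.\<close>

lemma radius_starlike_eq:
  assumes R: "R > 0" "G.limfun R = (0::real)" and pos: "\<And>t::real. 0 \<le> t \<Longrightarrow> t < R \<Longrightarrow> G.limfun t > 0"
  shows "radius_starlike (\<lambda>z. z * F.limfun z) = R"
proof -
  have d: "deriv (\<lambda>z. z * F.limfun z) z = G.limfun z" for z :: complex
    by (rule DERIV_imp_deriv[OF H_deriv])
  show ?thesis unfolding radius_starlike_def
  proof (rule cSup_eq_maximum)
    show "R \<in> {r. r > 0 \<and> (\<forall>z. 0 < cmod z \<and> cmod z < r \<longrightarrow> Re (z * deriv (\<lambda>z. z * F.limfun z) z / (z * F.limfun z)) > 0)}"
      unfolding d using R(1) pos starlike_inside by auto
    fix r assume r: "r \<in> {r. r > 0 \<and> (\<forall>z. 0 < cmod z \<and> cmod z < r \<longrightarrow> Re (z * deriv (\<lambda>z. z * F.limfun z) z / (z * F.limfun z)) > 0)}"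
    show "r \<le> R"
    proof (rule ccontr)
      assume "\<not> r \<le> R"
      then have "Re (of_real R * G.limfun (of_real R :: complex) / (of_real R * F.limfun (of_real R :: complex))) > 0"
        using r R(1) unfolding d by auto
      then show False unfolding G.limfun_of_real R(2) by simp
    qed
  qed
qed

end

section \<open>The Jackson function in terms of \<open>h\<close>\<close>

lemma qpoch_inf_nonzero:
  assumes "0 < q" "q < 1" "0 < c" "c < 1"
  shows "qpoch_inf c q \<noteq> 0"
  unfolding qpoch_inf_def
proof (rule prodinf_nonzero)
  have "summable (\<lambda>k. norm (1 - c * q ^ k - 1))"
    using assms by (simp add: abs_mult power_abs summable_mult summable_geometric)
  then show "convergent_prod (\<lambda>k. 1 - c * q ^ k)"
    by (intro abs_convergent_prod_imp_convergent_prod summable_imp_abs_convergent_prod)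
  fix k
  have "c * q ^ k < 1" using mult_left_mono[OF power_le_one[of q k], of c] assms by linarith
  then show "1 - c * q ^ k \<noteq> 0" by simp
qed

lemma qbessel_hcoef:
  assumes "0 < q" "q < 1" "\<nu> > -1"
  shows "qbessel q (q powr (\<nu> + 1)) (hcoef \<nu> q)"
proof
  define b where "b = q powr (\<nu> + 1)"
  show "0 < q powr (\<nu> + 1)" "q powr (\<nu> + 1) < 1" using assms using powr_less_mono2[of "\<nu> + 1" q 1] by auto
  fix n
  \<comment> \<open>The increment \<open>2 n + \<nu> + 1\<close> of the exponent produces the factor
    \<open>q ^ (2 * n) * b\<close> of the recurrence.\<close>
  have "real (Suc n) * (real (Suc n) + \<nu>) = real n * (real n + \<nu>) + (real (2 * n) + (\<nu> + 1))"
    by (simp add: algebra_simps)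
  then have e: "q powr (real (Suc n) * (real (Suc n) + \<nu>)) = q powr (real n * (real n + \<nu>)) * (q ^ (2 * n) * b)"
    using assms(1) by (simp only: powr_add powr_realpow b_def)
  have s: "qpoch c q (Suc n) = qpoch c q n * (1 - c * q ^ n)" for c by (simp add: qpoch_def)
  show "hcoef \<nu> q (Suc n) = - hcoef \<nu> q n * (q ^ (2 * n) * (q powr (\<nu> + 1) / 4) / ((1 - q ^ Suc n) * (1 - q powr (\<nu> + 1) * q ^ n)))"
    unfolding hcoef_def e s b_def[symmetric] by (simp add: power_mult mult_ac)
qed (use assms in \<open>simp_all add: hcoef_def qpoch_def\<close>)

lemma h2_eq:
  assumes "0 < q" "q < 1" "\<nu> > -1"
  shows "h2 \<nu> q = (\<lambda>z. z * poly_limit.limfun (hcoef \<nu> q) z)"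
proof
  interpret qbessel q "q powr (\<nu> + 1)" "hcoef \<nu> q" using assms by (rule qbessel_hcoef)
  fix z
  show "h2 \<nu> q z = z * F.limfun z"
    using suminf_mult[OF F.summable_limfun[of z], of z] by (simp add: h2_def F.limfun_def mult_ac)
qed

text \<open>Splitting \<open>(r/2)^2\<close> off the power \<open>(r/2) powr \<nu>\<close> exposes
  \<open>h(r^2)\<close>, with the exponent \<open>\<nu> - 2\<close> that occurs in the equation for
  the radius.\<close>

lemma jacksonJ2_eq:
  assumes "0 < q" "q < 1" "\<nu> > -1" "r > 0"
  defines "C \<equiv> qpoch_inf (q powr (\<nu> + 1)) q / qpoch_inf q q"
  shows "jacksonJ2 \<nu> q r = C / 4 * (r / 2) powr (\<nu> - 2) * (r\<^sup>2 * poly_limit.limfun (hcoef \<nu> q) (r\<^sup>2))"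
proof -
  interpret qbessel q "q powr (\<nu> + 1)" "hcoef \<nu> q" using assms(1-3) by (rule qbessel_hcoef)
  have t: "(-1) ^ n * (r / 2) powr (2 * real n + \<nu>) * q powr (real n * (real n + \<nu>))
            / (qpoch q q n * qpoch (q powr (\<nu> + 1)) q n) = (r / 2) powr \<nu> * (hcoef \<nu> q n * (r\<^sup>2) ^ n)" for n
  proof -
    have "(r / 2) powr (2 * real n + \<nu>) = (r / 2) powr (real (2 * n)) * (r / 2) powr \<nu>"
      by (simp add: powr_add)
    also have "\<dots> = (r\<^sup>2) ^ n / 2 ^ (2 * n) * (r / 2) powr \<nu>"
      using assms(4) by (subst powr_realpow) (auto simp: power_divide power_mult)
    finally show ?thesis by (simp add: hcoef_def mult_ac)
  qed
  have "summable (\<lambda>n. hcoef \<nu> q n * (r\<^sup>2) ^ n)" using F.summable_limfun[of "r\<^sup>2"] by simp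
  then have "jacksonJ2 \<nu> q r = C * ((r / 2) powr \<nu> * F.limfun (r\<^sup>2))"
    unfolding jacksonJ2_def t C_def F.limfun_def by (subst suminf_mult) auto
  also have "(r / 2) powr \<nu> = (r / 2) powr (\<nu> - 2) * (r / 2) powr (real 2)"
    by (simp flip: powr_add)
  also have "(r / 2) powr (real 2) = r\<^sup>2 / 4"
    using assms(4) by (subst powr_realpow) (auto simp: power_divide)
  finally show ?thesis by simp
qed

text \<open>Subtracting \<open>(\<nu> - 2) * J\<close> cancels exactly the derivative of the power
  prefactor, leaving a multiple of \<open>h'(r^2)\<close>.\<close>

lemma jacksonJ2_deriv:
  assumes "0 < q" "q < 1" "\<nu> > -1" "r > 0"
  defines "C \<equiv> qpoch_inf (q powr (\<nu> + 1)) q / qpoch_inf q q"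
  shows "r * deriv (jacksonJ2 \<nu> q) r - (\<nu> - 2) * jacksonJ2 \<nu> q r =
    C / 2 * (r / 2) powr (\<nu> - 2) * r\<^sup>2 * poly_limit.limfun (\<lambda>k. real (Suc k) * hcoef \<nu> q k) (r\<^sup>2)"
proof -
  interpret qbessel q "q powr (\<nu> + 1)" "hcoef \<nu> q" using assms(1-3) by (rule qbessel_hcoef)
  define H where "H = (\<lambda>x::real. x * F.limfun x)"
  have dH: "(H has_real_derivative G.limfun x) (at x)" for x unfolding H_def by (rule H_deriv)
  define A where "A = (r / 2) powr (\<nu> - 2)"
  have dA: "((\<lambda>r. (r / 2) powr (\<nu> - 2)) has_real_derivative (\<nu> - 2) * A / r) (at r)"
  proof -
    have "r ^ 4 = r * (r * r\<^sup>2)" by (simp add: eval_nat_numeral)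
    then show ?thesis using assms(4) by (auto intro!: derivative_eq_intros simp: A_def powr_diff field_simps)
  qed
  have dH2: "((\<lambda>r. H (r\<^sup>2)) has_real_derivative G.limfun (r\<^sup>2) * (2 * r)) (at r)"
    by (rule DERIV_chain2[OF dH]) (auto intro!: derivative_eq_intros)
  have "((\<lambda>r. C / 4 * (r / 2) powr (\<nu> - 2) * H (r\<^sup>2)) has_real_derivative
      (C / 4 * ((\<nu> - 2) * A / r)) * H (r\<^sup>2) + C / 4 * A * (G.limfun (r\<^sup>2) * (2 * r))) (at r)"
    using DERIV_mult[OF DERIV_cmult[OF dA, of "C / 4"] dH2] unfolding A_def[symmetric]
    by (simp only: mult_ac)
  \<comment> \<open>The closed form holds for positive arguments; these form an open set, which
    suffices for the derivative at \<open>r\<close>.\<close>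
  then have "(jacksonJ2 \<nu> q has_real_derivative
      (C / 4 * ((\<nu> - 2) * A / r)) * H (r\<^sup>2) + C / 4 * A * (G.limfun (r\<^sup>2) * (2 * r))) (at r)"
    by (rule has_field_derivative_transform_within_open[where S = "{0<..}"])
       (use assms jacksonJ2_eq in \<open>auto simp: H_def C_def\<close>)
  then have "deriv (jacksonJ2 \<nu> q) r = (C / 4 * ((\<nu> - 2) * A / r)) * H (r\<^sup>2) + C / 4 * A * (G.limfun (r\<^sup>2) * (2 * r))"
    by (rule DERIV_imp_deriv)
  moreover have "jacksonJ2 \<nu> q r = C / 4 * A * H (r\<^sup>2)"
    using jacksonJ2_eq[OF assms(1-4)] by (simp add: A_def H_def C_def)
  moreover have "r * ((C / 4 * ((\<nu> - 2) * A / r)) * h + C / 4 * A * (g * (2 * r))) - (\<nu> - 2) * (C / 4 * A * h) =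
     C / 2 * A * r\<^sup>2 * g" for g h
    using assms(4) by (simp add: field_simps power2_eq_square)
  ultimately show ?thesis by (simp only: A_def)
qed

text \<open>In the application \<open>e\<close>, \<open>g\<close>, \<open>h\<close>,
  \<open>k\<close>, \<open>w\<close>, \<open>s\<close> are \<open>1 - q\<close>,
  \<open>1 - b\<close>, \<open>1 - b q\<close>, \<open>1 - b q^2\<close>, \<open>1 + q\<close>,
  \<open>1 + q + q^2\<close>. As independent nonzero symbols they keep the rational identities
  small.\<close>

lemma root_power_sums:
  fixes q b e g h k w s :: real
  assumes "e \<noteq> 0" "g \<noteq> 0" "h \<noteq> 0" "k \<noteq> 0" "w \<noteq> 0" "s \<noteq> 0"
  defines "a1 \<equiv> - (b / 4 / (e * g))"
  defines "a2 \<equiv> - a1 * (q ^ 2 * (b / 4) / (e * w * h))"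
  defines "a3 \<equiv> - a2 * (q ^ 4 * (b / 4) / (e * s * k))"
  shows "(2 * a1)\<^sup>2 - 2 * (3 * a2) = b\<^sup>2 * (2 * w * h - 3 * q\<^sup>2 * g) / (8 * e\<^sup>2 * g\<^sup>2 * w * h)" (is "?K1 = ?R1")
    and "- 3 * (4 * a3) - 2 * a1 * ((2 * a1)\<^sup>2 - 2 * (3 * a2)) - 3 * a2 * (- (2 * a1)) =
       b ^ 3 * (6 * q ^ 6 * g\<^sup>2 + 4 * w * h * s * k - 9 * q\<^sup>2 * g * s * k) / (32 * e ^ 3 * g ^ 3 * w * h * s * k)"
proof -
  show "?K1 = ?R1"
    unfolding a1_def a2_def using assms(1-6) by (simp add: divide_simps) algebra
  show "- 3 * (4 * a3) - 2 * a1 * ?K1 - 3 * a2 * (- (2 * a1)) =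
       b ^ 3 * (6 * q ^ 6 * g\<^sup>2 + 4 * w * h * s * k - 9 * q\<^sup>2 * g * s * k) / (32 * e ^ 3 * g ^ 3 * w * h * s * k)"
    unfolding a1_def a2_def a3_def using assms(1-6) by (simp add: divide_simps) algebra
qed

section \<open>Explicit bounds for the smallest root\<close>

context qbessel
begin

text \<open>With \<open>R = 1/X\<close> the four bounds are, in order, \<open>X < K0\<close>,
  \<open>K1 < X * K0\<close>, \<open>X^2 < K1\<close> and \<open>K2 < X * K1\<close>.\<close>

lemma root_bounds:
  defines "u \<equiv> 2 * (1 + q) * (1 - b * q) - 3 * q\<^sup>2 * (1 - b)"
  defines "v \<equiv> 6 * q ^ 6 * (1 - b)\<^sup>2 + 4 * (1 + q) * (1 - b * q) * (1 + q + q\<^sup>2) * (1 - b * q\<^sup>2)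
    - 9 * q\<^sup>2 * (1 - b) * (1 + q + q\<^sup>2) * (1 - b * q\<^sup>2)"
  shows "\<exists>R>0. G.limfun R = (0::real) \<and> (\<forall>t::real. 0 \<le> t \<and> t < R \<longrightarrow> G.limfun t > 0) \<and>
    2 * (1 - q) * (1 - b) / b < R \<and>
    R < 4 * (1 - b) * (1 - b * q) * (1 - q\<^sup>2) / (b * u) \<and>
    sqrt (8 * (1 - b)\<^sup>2 * (1 - b * q) * (1 - q)\<^sup>2 * (1 + q) / (b\<^sup>2 * u)) < R \<and>
    R < 4 * (1 - b) * (1 - b * q\<^sup>2) * (1 - q ^ 3) / b * (u / v)"
proof -
  define e g h k w s where "e = 1 - q" and "g = 1 - b" and "h = 1 - b * q" and "k = 1 - b * q\<^sup>2"
    and "w = 1 + q" and "s = 1 + q + q\<^sup>2"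
  have pos: "e > 0" "g > 0" "h > 0" "k > 0" "w > 0" "s > 0"
    using q b bq_lt_1[of 1] bq_lt_1[of 2]
    by (auto simp: e_def g_def h_def k_def w_def s_def add_pos_pos)
  then have nz: "e \<noteq> 0" "g \<noteq> 0" "h \<noteq> 0" "k \<noteq> 0" "w \<noteq> 0" "s \<noteq> 0" by auto
  have ew: "1 - q\<^sup>2 = e * w" and es: "1 - q ^ 3 = e * s"
    by (simp_all add: e_def w_def s_def algebra_simps power2_eq_square power3_eq_cube)
  have a1: "a 1 = - (b / 4 / (e * g))"
    using a_Suc[of 0] a_0 by (simp add: e_def g_def)
  have a2: "a 2 = - a 1 * (q ^ 2 * (b / 4) / (e * w * h))"
    using a_Suc[of 1] by (simp add: numeral_2_eq_2[symmetric] ew h_def)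
  have a3: "a 3 = - a 2 * (q ^ 4 * (b / 4) / (e * s * k))"
    using a_Suc[of 2] by (simp add: es k_def numeral_3_eq_3[symmetric])
  have u_eq: "u = 2 * w * h - 3 * q\<^sup>2 * g" by (simp add: u_def w_def h_def g_def)
  have v_eq: "v = 6 * q ^ 6 * g\<^sup>2 + 4 * w * h * s * k - 9 * q\<^sup>2 * g * s * k"
    by (simp add: v_def w_def h_def g_def s_def k_def)
  define K0 K1 K2 where "K0 = - m 1" and "K1 = (m 1)\<^sup>2 - 2 * m 2"
    and "K2 = - 3 * m 3 - m 1 * K1 - m 2 * K0"
  have m: "m 1 = 2 * a 1" "m 2 = 3 * a 2" "m 3 = 4 * a 3" by simp_all
  note sums = root_power_sums[OF nz, of b q, folded a1, folded a2, folded a3]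
  have K0: "K0 = b / (2 * e * g)" unfolding K0_def m a1 by simp
  have K1: "K1 = b\<^sup>2 * u / (8 * e\<^sup>2 * g\<^sup>2 * w * h)" unfolding K1_def m u_eq by (rule sums(1))
  have K2: "K2 = b ^ 3 * v / (32 * e ^ 3 * g ^ 3 * w * h * s * k)"
    unfolding K2_def K1_def K0_def m v_eq by (rule sums(2))
  \<comment> \<open>Needed for \<open>K1 > 0\<close>. It follows from \<open>h \<ge> g\<close> and
    \<open>3 q^2 < 3 q < 2 (1 + q)\<close>.\<close>
  have u: "u > 0"
  proof -
    have "h \<ge> g" using q b by (simp add: h_def g_def mult_left_le)
    then have "2 * w * g \<le> 2 * w * h" using pos by simp
    moreover have "q\<^sup>2 < q" using q by (simp add: power2_eq_square)
    then have "3 * q\<^sup>2 * g < 2 * w * g" using q pos by (intro mult_strict_right_mono) (auto simp: w_def)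
    ultimately show ?thesis unfolding u_eq by linarith
  qed
  have K1pos: "K1 > 0" unfolding K1 using u b pos by (intro divide_pos_pos mult_pos_pos) auto
  have "\<exists>X>0. G.limfun (1 / X) = (0::real) \<and> (\<forall>t::real. 0 \<le> t \<and> t < 1 / X \<longrightarrow> G.limfun t > 0) \<and>
    X < K0 \<and> K1 < X * K0 \<and> X\<^sup>2 < K1 \<and> K2 < X * K1 \<and> 0 < K2"
    using K1pos unfolding K0_def K1_def K2_def by (rule smallest_root)
  then obtain X where X: "X > 0" "G.limfun (1 / X) = (0::real)"
      "\<And>t::real. 0 \<le> t \<Longrightarrow> t < 1 / X \<Longrightarrow> G.limfun t > 0"
    and ineq: "X < K0" "K1 < X * K0" "X\<^sup>2 < K1" "K2 < X * K1" "0 < K2"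
    by blast
  have "2 * (1 - q) * (1 - b) / b < 1 / X"
  proof -
    have "1 / K0 < 1 / X" using X(1) ineq(1) by (intro divide_strict_left_mono) auto
    then show ?thesis unfolding K0 by (simp add: e_def g_def)
  qed
  moreover have "1 / X < 4 * (1 - b) * (1 - b * q) * (1 - q\<^sup>2) / (b * u)"
  proof -
    have "1 / X < K0 / K1" using X(1) ineq(2) K1pos by (simp add: field_simps)
    also have "\<dots> = 4 * g * h * (e * w) / (b * u)"
      unfolding K0 K1 using nz b u by (simp add: field_simps power2_eq_square)
    finally show ?thesis unfolding ew by (simp add: g_def h_def)
  qed
  moreover have "sqrt (8 * (1 - b)\<^sup>2 * (1 - b * q) * (1 - q)\<^sup>2 * (1 + q) / (b\<^sup>2 * u)) < 1 / X"
  proof -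
    have "8 * (1 - b)\<^sup>2 * (1 - b * q) * (1 - q)\<^sup>2 * (1 + q) / (b\<^sup>2 * u) = 1 / K1"
      unfolding K1 by (simp add: mult_ac e_def g_def h_def w_def)
    also have "\<dots> < 1 / X\<^sup>2" using X(1) ineq(3) K1pos by (intro divide_strict_left_mono) auto
    also have "\<dots> = (1 / X)\<^sup>2" by (simp add: power_divide)
    finally show ?thesis using X(1) by (intro real_less_lsqrt) auto
  qed
  moreover have "1 / X < 4 * (1 - b) * (1 - b * q\<^sup>2) * (1 - q ^ 3) / b * (u / v)"
  proof -
    have v: "v \<noteq> 0" using ineq(5) unfolding K2 by auto
    have "1 / X < K1 / K2" using X(1) ineq(4,5) by (simp add: field_simps)
    also have "\<dots> = 4 * g * k * (e * s) / b * (u / v)"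
      unfolding K1 K2 using nz b v by (simp add: field_simps power2_eq_square power3_eq_cube)
    finally show ?thesis unfolding es by (simp add: g_def k_def)
  qed
  ultimately show ?thesis using X by (intro exI[of _ "1 / X"]) auto
qed

end

lemma radius_starlike_h2:
  fixes q \<nu> :: real
  assumes q: "0 < q" "q < 1" and \<nu>: "\<nu> > -1"
  defines "b \<equiv> q powr (\<nu> + 1)" and "rs \<equiv> radius_starlike (h2 \<nu> q)"
  defines "P \<equiv> 2 * (1 + q) * (1 - b * q) - 3 * q\<^sup>2 * (1 - b)"
  defines "D \<equiv> 6 * q ^ 6 * (1 - b)\<^sup>2 + 4 * (1 + q) * (1 - b * q) * (1 + q + q\<^sup>2) * (1 - b * q\<^sup>2)
    - 9 * q\<^sup>2 * (1 - b) * (1 + q + q\<^sup>2) * (1 - b * q\<^sup>2)"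
  shows "\<exists>r0>0. r0 * deriv (jacksonJ2 \<nu> q) r0 - (\<nu> - 2) * jacksonJ2 \<nu> q r0 = 0 \<and>
      (\<forall>r. 0 < r \<and> r < r0 \<longrightarrow> r * deriv (jacksonJ2 \<nu> q) r - (\<nu> - 2) * jacksonJ2 \<nu> q r \<noteq> 0) \<and> rs = r0 ^ 2"
    and "2 * (1 - q) * (1 - b) / b < rs"
    and "rs < 4 * (1 - b) * (1 - b * q) * (1 - q\<^sup>2) / (b * P)"
    and "sqrt (8 * (1 - b)\<^sup>2 * (1 - b * q) * (1 - q)\<^sup>2 * (1 + q) / (b\<^sup>2 * P)) < rs"
    and "rs < 4 * (1 - b) * (1 - b * q\<^sup>2) * (1 - q ^ 3) / b * (P / D)"
proof -
  interpret B: qbessel q b "hcoef \<nu> q" unfolding b_def using q \<nu> by (rule qbessel_hcoef)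
  obtain R where R: "R > 0" "B.G.limfun R = (0::real)" "\<And>t::real. 0 \<le> t \<Longrightarrow> t < R \<Longrightarrow> B.G.limfun t > 0"
    and bounds: "2 * (1 - q) * (1 - b) / b < R"
      "R < 4 * (1 - b) * (1 - b * q) * (1 - q\<^sup>2) / (b * P)"
      "sqrt (8 * (1 - b)\<^sup>2 * (1 - b * q) * (1 - q)\<^sup>2 * (1 + q) / (b\<^sup>2 * P)) < R"
      "R < 4 * (1 - b) * (1 - b * q\<^sup>2) * (1 - q ^ 3) / b * (P / D)"
    using B.root_bounds unfolding P_def D_def by blast
  have rs: "rs = R"
    unfolding rs_def h2_eq[OF q \<nu>] using R by (intro B.radius_starlike_eq) auto
  define C where "C = qpoch_inf (q powr (\<nu> + 1)) q / qpoch_inf q q"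
  have "C \<noteq> 0" unfolding C_def b_def[symmetric] using qpoch_inf_nonzero q B.b by simp
  have J: "r * deriv (jacksonJ2 \<nu> q) r - (\<nu> - 2) * jacksonJ2 \<nu> q r = 0 \<longleftrightarrow> B.G.limfun (r\<^sup>2) = 0" if "r > 0" for r
    unfolding jacksonJ2_deriv[OF q \<nu> that] C_def[symmetric] using \<open>C \<noteq> 0\<close> that by simp
  show "\<exists>r0>0. r0 * deriv (jacksonJ2 \<nu> q) r0 - (\<nu> - 2) * jacksonJ2 \<nu> q r0 = 0 \<and>
      (\<forall>r. 0 < r \<and> r < r0 \<longrightarrow> r * deriv (jacksonJ2 \<nu> q) r - (\<nu> - 2) * jacksonJ2 \<nu> q r \<noteq> 0) \<and> rs = r0 ^ 2"
  \<comment> \<open>The Bessel function enters \<open>h\<close> at the square root of the argument,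
    so the smallest root of its equation is \<open>sqrt R\<close>.\<close>
  proof (intro exI[of _ "sqrt R"] conjI allI impI)
    show "sqrt R > 0" using R by simp
    have sq: "(sqrt R)\<^sup>2 = R" using R by simp
    then show "rs = (sqrt R)\<^sup>2" using rs by simp
    show "sqrt R * deriv (jacksonJ2 \<nu> q) (sqrt R) - (\<nu> - 2) * jacksonJ2 \<nu> q (sqrt R) = 0"
      using J[OF \<open>sqrt R > 0\<close>] R(2) unfolding sq by blast
    fix r assume r: "0 < r \<and> r < sqrt R"
    then have "r\<^sup>2 < R" using sq by (metis less_imp_le pos2 power_strict_mono)
    then have "B.G.limfun (r\<^sup>2) \<noteq> 0" using R(3)[of "r\<^sup>2"] by force
    then show "r * deriv (jacksonJ2 \<nu> q) r - (\<nu> - 2) * jacksonJ2 \<nu> q r \<noteq> 0" using J r by blast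
  qed
  show "2 * (1 - q) * (1 - b) / b < rs"
    and "rs < 4 * (1 - b) * (1 - b * q) * (1 - q\<^sup>2) / (b * P)"
    and "sqrt (8 * (1 - b)\<^sup>2 * (1 - b * q) * (1 - q)\<^sup>2 * (1 + q) / (b\<^sup>2 * P)) < rs"
    and "rs < 4 * (1 - b) * (1 - b * q\<^sup>2) * (1 - q ^ 3) / b * (P / D)"
    unfolding rs by (fact bounds)+
qed

theorem theorem3:
  fixes q \<nu> :: real
  assumes "0 < q" "q < 1" "\<nu> > -1"
  defines "P \<equiv> 2*q - 2*q powr (\<nu>+2) + q powr (\<nu>+3) - 3*q^2 + 2"
      and "c \<equiv> 4*q powr (\<nu>+2) + 3*q powr (\<nu>+3) + 7*q powr (\<nu>+4) - 6*q powr (\<nu>+5)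
               - 5*q powr (\<nu>+6) + 3*q powr (\<nu>+7) - 4*q powr (2*\<nu>+5) + q powr (2*\<nu>+6)"
      and "d \<equiv> q powr (2*\<nu>+7) - q powr (2*\<nu>+8) - 8*q + q^2 + 5*q^3 + 9*q^4 - 6*q^6 - 4"
      and "rs \<equiv> radius_starlike (h2 \<nu> q)"
  shows "(\<exists>r0>0. r0 * deriv (jacksonJ2 \<nu> q) r0 - (\<nu> - 2) * jacksonJ2 \<nu> q r0 = 0 \<and>
            (\<forall>r. 0 < r \<and> r < r0 \<longrightarrow> r * deriv (jacksonJ2 \<nu> q) r - (\<nu> - 2) * jacksonJ2 \<nu> q r \<noteq> 0) \<and>
            rs = r0 ^ 2)
       \<and> 2*(1-q)*(1 - q powr (\<nu>+1)) / q powr (\<nu>+1) < rs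
       \<and> rs < 4*(q powr (\<nu>+1) - 1)*(q powr (\<nu>+2) - 1)*(1 - q^2) / (q powr (\<nu>+1) * P)
       \<and> sqrt (8*(q powr (\<nu>+1) - 1)^2*(1 - q powr (\<nu>+2))*(q-1)^2*(q+1) / (q powr (2*\<nu>+2) * P)) < rs
       \<and> rs < 4*(q powr (\<nu>+1) - 1)*(q powr (\<nu>+3) - 1)*(q^3 - 1) / q powr (\<nu>+1) * (P / (c + d))"
proof -
  define b where "b = q powr (\<nu> + 1)"
  have p1: "q powr (\<nu> + 1 + real n) = b * q ^ n" for n
    using assms(1) unfolding b_def powr_add[of q "\<nu> + 1"] by (simp add: powr_realpow)
  have p2: "q powr (2 * \<nu> + 2 + real n) = b\<^sup>2 * q ^ n" for n
  proof -
    have "2 * \<nu> + 2 + real n = (\<nu> + 1) + (\<nu> + 1) + real n" by simp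
    then show ?thesis using assms(1) unfolding b_def
      by (simp only: powr_add[of q "(\<nu> + 1) + (\<nu> + 1)"] powr_add[of q "\<nu> + 1" "\<nu> + 1"] power2_eq_square powr_realpow)
  qed
  have pw: "q powr (\<nu> + 1) = b" "q powr (\<nu> + 2) = b * q" "q powr (\<nu> + 3) = b * q ^ 2" "q powr (\<nu> + 4) = b * q ^ 3"
    "q powr (\<nu> + 5) = b * q ^ 4" "q powr (\<nu> + 6) = b * q ^ 5" "q powr (\<nu> + 7) = b * q ^ 6"
    "q powr (2 * \<nu> + 2) = b\<^sup>2" "q powr (2 * \<nu> + 5) = b\<^sup>2 * q ^ 3" "q powr (2 * \<nu> + 6) = b\<^sup>2 * q ^ 4"
    "q powr (2 * \<nu> + 7) = b\<^sup>2 * q ^ 5" "q powr (2 * \<nu> + 8) = b\<^sup>2 * q ^ 6"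
    using p1[of 0] p1[of 1] p1[of 2] p1[of 3] p1[of 4] p1[of 5] p1[of 6]
      p2[of 0] p2[of 3] p2[of 4] p2[of 5] p2[of 6] by (simp_all add: add.assoc)
  have PP: "P = 2 * (1 + q) * (1 - b * q) - 3 * q\<^sup>2 * (1 - b)"
    unfolding P_def pw by (simp add: algebra_simps power2_eq_square)
  \<comment> \<open>The displayed denominator is minus the one in \<open>radius_starlike_h2\<close>;
    the sign is absorbed by the factor \<open>q ^ 3 - 1\<close>, which is negative.\<close>
  have cd: "c + d = - (6 * q ^ 6 * (1 - b)\<^sup>2 + 4 * (1 + q) * (1 - b * q) * (1 + q + q\<^sup>2) * (1 - b * q\<^sup>2)
      - 9 * q\<^sup>2 * (1 - b) * (1 + q + q\<^sup>2) * (1 - b * q\<^sup>2))"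
    unfolding c_def d_def pw by (simp add: power2_eq_square) algebra
  have signs: "4 * (b - 1) * (b * q - 1) * (1 - q\<^sup>2) = 4 * (1 - b) * (1 - b * q) * (1 - q\<^sup>2)"
    "8 * (b - 1)\<^sup>2 * (1 - b * q) * (q - 1)\<^sup>2 * (q + 1) = 8 * (1 - b)\<^sup>2 * (1 - b * q) * (1 - q)\<^sup>2 * (1 + q)"
    "4 * (b - 1) * (b * q\<^sup>2 - 1) * (q ^ 3 - 1) = - (4 * (1 - b) * (1 - b * q\<^sup>2) * (1 - q ^ 3))"
    by algebra+
  have neg: "- x / y * (u / - v) = x / y * (u / v)" for x y u v :: real by simp
  show ?thesis
    using radius_starlike_h2[OF assms(1-3)] unfolding rs_def pw signs cd PP neg b_def[symmetric]
    by (intro conjI)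
qed

end
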